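(* Let $\Omega\subset\mathbb R^n$ be open with respect to a distance $\mathsf d$ satisfying the following symmetry condition: for any $x\in\Omega$ and $r>0$ such that $B_r(x)\subset\Omega$, and for any $v\in\mathbb R^n$, $$x+v\in B_r(x)\iff x-v\in B_r(x),$$ where $B_r(x)$ denotes the $\mathsf d$-ball. For $w\in C^1(\Omega)$, let $\mu$ be the measure on $\Omega$ with density $w$ with respect to the Lebesgue measure $\mathscr L^n$ restricted to $\Omega$. Consider $(\Omega,\mathsf d,\mu)$. Let $x\in\Omega$ be such that $w(x)>0$. For $r>0$, let $M^r(x)$ be the $n\times n$ matrix with entries $$M^r_{ij}(x):=\frac1{r^2}\fint_{B_r(x)}(y-x)_i(y-x)_j\,dy,\qquad 1\le i,j\le n.$$ (1) Assume that the limit $M(x):=\lim_{r\downarrow0}M^r(x)$ exists. Then any $u\in C^2(\Omega)$ admits a pointwise AMV Laplacian at $x$, and $$\Delta^{\mathsf d}_\mu u(x)=\frac12\mathrm{Tr}(M(x)\nabla^2u(x))+\frac1{w(x)}\langle\nabla w(x),M(x)\nabla u(x)\rangle .$$ (2) If in addition $$\fint_{B_r(x)}\left|1-\frac{\mathscr L^n(B_r(x))}{\mathscr L^n(B_r(y))}\right|dy=o(r)\qquad\text{as } r\downarrow0,$$ then $u$ admits a pointwise SAMV Laplacian at $x$, and $$\tilde\Delta^{\mathsf d}_\mu u(x)=\frac1{2w(x)}\mathrm{Tr}\big(M(x)\nabla(w\nabla u)(x)\big).$$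
   Context: A metric measure space $(X,\mathsf d,\mu)$ is a metric space $(X,\mathsf d)$ with a fully supported Borel measure $\mu$ such that $0<\mu(B_r(x))<+\infty$ for all $x\in X$, $r>0$, where $B_r(x)$ is the $\mathsf d$-ball of center $x$ and radius $r$. Here $(\Omega,\mathsf d,\mu)$ is regarded as such a space. $\fint_A f\,d\mu:=\frac1{\mu(A)}\int_A f\,d\mu$, and $\fint_A f\,dy$ is the average with respect to Lebesgue measure. $\nabla$ and $\nabla^2$ are the usual gradient and Hessian on $\mathbb R^n$; $\nabla(w\nabla u)$ is the matrix $w\nabla^2u+\nabla w\otimes\nabla u$, so that $\frac1{2w}\mathrm{Tr}(M\nabla(w\nabla u))=\frac12\mathrm{Tr}(M\nabla^2u)+\frac1{2w}\langle M\nabla u,\nabla w\rangle$. A point $x$ is a Lebesgue point of a locally integrable function $u$ if there is a real number $u^*(x)$ such that $\fint_{B_r(x)}|u(y)-u^*(x)|\,d\mu(y)\to0$ as $r\downarrow0$ (for the functions $u\in C^2(\Omega)$ considered here, $u^*(x)$ is $u(x)$). For such $x$ and $r>0$, $$\Delta^{\mathsf d}_{\mu,r}u(x):=\frac1{r^2}\fint_{B_r(x)}(u(y)-u^*(x))\,d\mu(y),\qquad \tilde\Delta^{\mathsf d}_{\mu,r}u(x):=\frac1{2r^2}\fint_{B_r(x)}(u(y)-u^*(x))\left(1+\frac{\mu(B_r(x))}{\mu(B_r(y))}\right)d\mu(y).$$ $u$ admits a pointwise AMV (asymptotic mean value) Laplacian at $x$ if the limit $\Delta^{\mathsf d}_\mu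 u(x):=\lim_{r\downarrow0}\Delta^{\mathsf d}_{\mu,r}u(x)$ exists as a real number, and a pointwise SAMV (symmetrized asymptotic mean value) Laplacian at $x$ if the limit $\tilde\Delta^{\mathsf d}_\mu u(x):=\lim_{r\downarrow0}\tilde\Delta^{\mathsf d}_{\mu,r}u(x)$ exists as a real number. *)

theory Defs
  imports "HOL-Analysis.Analysis" "HOL-Library.Landau_Symbols"
begin

section \<open>Averages and metric measure spaces\<close>

definition avg :: "'a measure \<Rightarrow> 'a set \<Rightarrow> ('a \<Rightarrow> real) \<Rightarrow> real" where
  "avg \<mu> A f = (LINT y:A|\<mu>. f y) / measure \<mu> A"

abbreviation dball :: "'a set \<Rightarrow> ('a \<Rightarrow> 'a \<Rightarrow> real) \<Rightarrow> 'a \<Rightarrow> real \<Rightarrow> 'a set" where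
  "dball X d \<equiv> Metric_space.mball X d"

abbreviation dopen :: "'a set \<Rightarrow> ('a \<Rightarrow> 'a \<Rightarrow> real) \<Rightarrow> 'a set \<Rightarrow> bool" where
  "dopen X d \<equiv> openin (Metric_space.mtopology X d)"

text \<open>The measure may be defined on more sets than the Borel sets of the metric topology.\<close>

definition metric_measure_space :: "'a set \<Rightarrow> ('a \<Rightarrow> 'a \<Rightarrow> real) \<Rightarrow> 'a measure \<Rightarrow> bool" where
  "metric_measure_space X d \<mu> \<longleftrightarrow>
     Metric_space X d \<and> space \<mu> = X \<and>
     (\<forall>U. dopen X d U \<longrightarrow> U \<in> sets \<mu>) \<and>
     (\<forall>U. dopen X d U \<and> U \<noteq> {} \<longrightarrow> 0 < emeasure \<mu> U) \<and>
     (\<forall>x\<in>X. \<forall>r>0. 0 < emeasure \<mu> (dball X d x r) \<and> emeasure \<mu> (dball X d x r) < \<infinity>)"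


section \<open>Lebesgue points and asymptotic mean value Laplacians\<close>

text \<open>The real number \<open>c\<close> is the value \<open>u\<^sup>*(x)\<close> at the Lebesgue point \<open>x\<close>.  Of the local
  integrability of \<open>u\<close> only the part at \<open>x\<close> matters; it is stated explicitly because the
  Bochner integral of a non-integrable function is \<open>0\<close>.\<close>

definition has_lebesgue_value ::
  "'a set \<Rightarrow> ('a \<Rightarrow> 'a \<Rightarrow> real) \<Rightarrow> 'a measure \<Rightarrow> ('a \<Rightarrow> real) \<Rightarrow> 'a \<Rightarrow> real \<Rightarrow> bool" where
  "has_lebesgue_value X d \<mu> u x c \<longleftrightarrow>
     (\<forall>\<^sub>F r in at_right 0. set_integrable \<mu> (dball X d x r) u) \<and>
     ((\<lambda>r. avg \<mu> (dball X d x r) (\<lambda>y. \<bar>u y - c\<bar>)) \<longlongrightarrow> 0) (at_right 0)"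

definition lebesgue_point ::
  "'a set \<Rightarrow> ('a \<Rightarrow> 'a \<Rightarrow> real) \<Rightarrow> 'a measure \<Rightarrow> ('a \<Rightarrow> real) \<Rightarrow> 'a \<Rightarrow> bool" where
  "lebesgue_point X d \<mu> u x \<longleftrightarrow> (\<exists>c. has_lebesgue_value X d \<mu> u x c)"

definition lebesgue_value ::
  "'a set \<Rightarrow> ('a \<Rightarrow> 'a \<Rightarrow> real) \<Rightarrow> 'a measure \<Rightarrow> ('a \<Rightarrow> real) \<Rightarrow> 'a \<Rightarrow> real" where
  "lebesgue_value X d \<mu> u x = (THE c. has_lebesgue_value X d \<mu> u x c)"

definition amv_quot ::
  "'a set \<Rightarrow> ('a \<Rightarrow> 'a \<Rightarrow> real) \<Rightarrow> 'a measure \<Rightarrow> real \<Rightarrow> ('a \<Rightarrow> real) \<Rightarrow> 'a \<Rightarrow> real" where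
  "amv_quot X d \<mu> r u x =
     1 / r\<^sup>2 * avg \<mu> (dball X d x r) (\<lambda>y. u y - lebesgue_value X d \<mu> u x)"

definition samv_integrand ::
  "'a set \<Rightarrow> ('a \<Rightarrow> 'a \<Rightarrow> real) \<Rightarrow> 'a measure \<Rightarrow> real \<Rightarrow> ('a \<Rightarrow> real) \<Rightarrow> 'a \<Rightarrow> 'a \<Rightarrow> real" where
  "samv_integrand X d \<mu> r u x y =
     (u y - lebesgue_value X d \<mu> u x) *
     (1 + measure \<mu> (dball X d x r) / measure \<mu> (dball X d y r))"

definition samv_quot ::
  "'a set \<Rightarrow> ('a \<Rightarrow> 'a \<Rightarrow> real) \<Rightarrow> 'a measure \<Rightarrow> real \<Rightarrow> ('a \<Rightarrow> real) \<Rightarrow> 'a \<Rightarrow> real" where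
  "samv_quot X d \<mu> r u x =
     1 / (2 * r\<^sup>2) * avg \<mu> (dball X d x r) (samv_integrand X d \<mu> r u x)"

definition admits_amv_laplacian ::
  "'a set \<Rightarrow> ('a \<Rightarrow> 'a \<Rightarrow> real) \<Rightarrow> 'a measure \<Rightarrow> ('a \<Rightarrow> real) \<Rightarrow> 'a \<Rightarrow> bool" where
  "admits_amv_laplacian X d \<mu> u x \<longleftrightarrow>
     lebesgue_point X d \<mu> u x \<and>
     (\<exists>L. ((\<lambda>r. amv_quot X d \<mu> r u x) \<longlongrightarrow> L) (at_right 0))"

definition amv_laplacian ::
  "'a set \<Rightarrow> ('a \<Rightarrow> 'a \<Rightarrow> real) \<Rightarrow> 'a measure \<Rightarrow> ('a \<Rightarrow> real) \<Rightarrow> 'a \<Rightarrow> real" where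
  "amv_laplacian X d \<mu> u x = Lim (at_right 0) (\<lambda>r. amv_quot X d \<mu> r u x)"

text \<open>Integrability of the integrand ensures that the quotients are meaningful for small \<open>r\<close>.\<close>

definition admits_samv_laplacian ::
  "'a set \<Rightarrow> ('a \<Rightarrow> 'a \<Rightarrow> real) \<Rightarrow> 'a measure \<Rightarrow> ('a \<Rightarrow> real) \<Rightarrow> 'a \<Rightarrow> bool" where
  "admits_samv_laplacian X d \<mu> u x \<longleftrightarrow>
     lebesgue_point X d \<mu> u x \<and>
     (\<forall>\<^sub>F r in at_right 0. set_integrable \<mu> (dball X d x r) (samv_integrand X d \<mu> r u x)) \<and>
     (\<exists>L. ((\<lambda>r. samv_quot X d \<mu> r u x) \<longlongrightarrow> L) (at_right 0))"

definition samv_laplacian ::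
  "'a set \<Rightarrow> ('a \<Rightarrow> 'a \<Rightarrow> real) \<Rightarrow> 'a measure \<Rightarrow> ('a \<Rightarrow> real) \<Rightarrow> 'a \<Rightarrow> real" where
  "samv_laplacian X d \<mu> u x = Lim (at_right 0) (\<lambda>r. samv_quot X d \<mu> r u x)"


section \<open>Differential calculus on Euclidean space\<close>

definition gradient :: "(real^'n \<Rightarrow> real) \<Rightarrow> real^'n \<Rightarrow> real^'n" where
  "gradient f x = (\<chi> i. frechet_derivative f (at x) (axis i 1))"

definition hessian :: "(real^'n \<Rightarrow> real) \<Rightarrow> real^'n \<Rightarrow> real^'n^'n" where
  "hessian f x = jacobian (gradient f) (at x)"

definition C1_on :: "(real^'n) set \<Rightarrow> (real^'n \<Rightarrow> real) \<Rightarrow> bool" where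
  "C1_on \<Omega> f \<longleftrightarrow> (\<forall>x\<in>\<Omega>. f differentiable (at x)) \<and> continuous_on \<Omega> (gradient f)"

definition C2_on :: "(real^'n) set \<Rightarrow> (real^'n \<Rightarrow> real) \<Rightarrow> bool" where
  "C2_on \<Omega> f \<longleftrightarrow> C1_on \<Omega> f \<and> (\<forall>x\<in>\<Omega>. gradient f differentiable (at x)) \<and>
     continuous_on \<Omega> (hessian f)"

definition outer_product :: "real^'n \<Rightarrow> real^'n \<Rightarrow> real^'n^'n" where
  "outer_product a b = (\<chi> i j. a $ i * b $ j)"

text \<open>The matrix \<open>\<nabla>(w\<nabla>u)\<close>, in the convention whose entry \<open>(i, j)\<close> is
  \<open>\<partial>\<^sub>i (w \<partial>\<^sub>j u)\<close>.\<close>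

definition grad_weighted_grad ::
  "(real^'n \<Rightarrow> real) \<Rightarrow> (real^'n \<Rightarrow> real) \<Rightarrow> real^'n \<Rightarrow> real^'n^'n" where
  "grad_weighted_grad w u x =
     w x *\<^sub>R hessian u x + outer_product (gradient w x) (gradient u x)"


section \<open>Data of the theorem\<close>

definition weighted_measure :: "(real^'n) set \<Rightarrow> (real^'n \<Rightarrow> real) \<Rightarrow> (real^'n) measure" where
  "weighted_measure \<Omega> w = density (lebesgue_on \<Omega>) (\<lambda>y. ennreal (w y))"

definition symmetric_balls ::
  "(real^'n) set \<Rightarrow> (real^'n \<Rightarrow> real^'n \<Rightarrow> real) \<Rightarrow> bool" where
  "symmetric_balls \<Omega> d \<longleftrightarrow>
     (\<forall>x\<in>\<Omega>. \<forall>r>0. dball UNIV d x r \<subseteq> \<Omega> \<longrightarrow>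
        (\<forall>v. x + v \<in> dball UNIV d x r \<longleftrightarrow> x - v \<in> dball UNIV d x r))"

definition moment_matrix ::
  "(real^'n \<Rightarrow> real^'n \<Rightarrow> real) \<Rightarrow> real \<Rightarrow> real^'n \<Rightarrow> real^'n^'n" where
  "moment_matrix d r x =
     (\<chi> i j. 1 / r\<^sup>2 * avg lebesgue (dball UNIV d x r) (\<lambda>y. (y - x) $ i * (y - x) $ j))"

definition volume_defect :: "(real^'n \<Rightarrow> real^'n \<Rightarrow> real) \<Rightarrow> real \<Rightarrow> real^'n \<Rightarrow> real^'n \<Rightarrow> real" where
  "volume_defect d r x y =
     \<bar>1 - measure lebesgue (dball UNIV d x r) / measure lebesgue (dball UNIV d y r)\<bar>"

end

theory Submission
  imports Defs
begin

text \<open>The reflections in two points of a small ball compose to a translation that changes the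
  \<open>d\<close>-distance to \<open>x\<close> only slightly, so a small \<open>d\<close>-ball, which has finite Lebesgue measure, is bounded in
  the Euclidean sense; iterating the reflections along the progression \<open>y + kv\<close> improves this to
  \<open>|z - y| \<le> C d(y, z)\<close> near \<open>x\<close>.  Hence \<open>B\<^sub>r(y)\<close> lies in the Euclidean ball of radius \<open>C r\<close>, uniformly
  for \<open>y\<close> near \<open>x\<close>, and Taylor's formula has errors \<open>o(r\<^sup>2)\<close>.  The odd terms average to \<open>0\<close> over the
  symmetric balls, and the quadratic terms produce the moment matrix.  For the symmetrized
  operator, \<open>\<mu>(B\<^sub>r(y)) = |B\<^sub>r(y)| (w(y) + o(r))\<close> uniformly in \<open>y\<close>, while \<open>u(y) - u(x) = O(r)\<close>; so,
  up to \<open>o(r\<^sup>2)\<close>, the extra term is the unweighted average of \<open>u - u(x)\<close>.\<close>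


section \<open>Averages over symmetric sets\<close>

text \<open>No relation between \<open>d\<close> and the Euclidean norm is given, so a small
  \<open>d\<close>-ball could a priori be unbounded or fail to shrink to its centre, and then
  Taylor's formula says nothing about it. The limit \<open>M\<close> does not supply this control:
  it concerns balls centred at \<open>x\<close> only, whereas the symmetrized operator involves
  balls centred at every nearby \<open>y\<close>, and an entry with a non-integrable integrand takes
  the default value 0. The control is therefore extracted from the symmetry and from finiteness of
  volume. Finite weighted measure of a ball cannot replace finite Lebesgue measure there, because
  \<open>w\<close> is bounded below only near \<open>x\<close> and the ball is not yet known to stay
  there; this is the role of \<open>finite_volume\<close>. The precision \<open>o(r)\<close> for
  ratios of measures is forced by scaling: the ratio multiplies \<open>u(y) - u(x) = O(r)\<close>,
  and the result is divided by \<open>r^2\<close>. The gradient of the weight alone would leave an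
  error of order \<open>r\<close>; the symmetry of each ball about its own centre removes
  it.\<close>

lemma tendsto_zero_abs_leI:
  fixes g :: "'a \<Rightarrow> real"
  assumes "\<And>\<epsilon>. 0 < \<epsilon> \<Longrightarrow> \<forall>\<^sub>F r in F. \<bar>g r\<bar> \<le> \<epsilon>"
  shows "(g \<longlongrightarrow> 0) F"
proof (rule tendstoI)
  fix \<epsilon> :: real
  assume "0 < \<epsilon>"
  then have "\<forall>\<^sub>F r in F. \<bar>g r\<bar> \<le> \<epsilon> / 2"
    by (intro assms) simp
  then show "\<forall>\<^sub>F r in F. dist (g r) 0 < \<epsilon>"
    by (rule eventually_mono) (use \<open>0 < \<epsilon>\<close> in \<open>simp add: dist_real_def\<close>)
qed

lemma set_integrable_bounded:
  fixes f :: "'a \<Rightarrow> real"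
  assumes "B \<in> fmeasurable \<mu>" "set_borel_measurable \<mu> B f" "\<And>y. y \<in> B \<Longrightarrow> \<bar>f y\<bar> \<le> c"
  shows "set_integrable \<mu> B f"
proof -
  \<comment> \<open>\<open>f\<close> is measurable only on \<open>B\<close>, so the criterion is
    applied to its extension by 0; the repeated indicator collapses at the end.\<close>
  have "integrable \<mu> (\<lambda>y. indicator B y *\<^sub>R (indicator B y *\<^sub>R f y))"
  proof (rule integrableI_bounded_set_indicator[where B = c])
    show "B \<in> sets \<mu>" "emeasure \<mu> B < \<infinity>"
      using assms(1) by (auto simp: fmeasurable_def)
    show "(\<lambda>y. indicator B y *\<^sub>R f y) \<in> borel_measurable \<mu>"
      using assms(2) by (simp add: set_borel_measurable_def)
    show "AE y in \<mu>. y \<in> B \<longrightarrow> norm (indicator B y *\<^sub>R f y) \<le> c"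
      using assms(3) by auto
  qed
  then show ?thesis
    unfolding set_integrable_def by (rule back_subst[of "integrable \<mu>"]) (auto simp: indicator_def)
qed

lemma set_integrable_const:
  fixes c :: real
  assumes "B \<in> fmeasurable \<mu>"
  shows "set_integrable \<mu> B (\<lambda>_. c)"
  using assms by (intro set_integrable_bounded[where c = "\<bar>c\<bar>"])
    (auto simp: set_borel_measurable_def fmeasurable_def)

lemma set_integral_const:
  fixes c :: real
  assumes "B \<in> fmeasurable \<mu>"
  shows "(LINT y:B|\<mu>. c) = c * measure \<mu> B"
  using assms by (simp add: set_lebesgue_integral_def fmeasurable_def)

lemma avg_add:
  assumes "set_integrable \<mu> B f" "set_integrable \<mu> B g"
  shows "avg \<mu> B (\<lambda>y. f y + g y) = avg \<mu> B f + avg \<mu> B g"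
  using assms by (simp add: avg_def add_divide_distrib)

lemma avg_mult: "avg \<mu> B (\<lambda>y. c * f y) = c * avg \<mu> B f"
  by (simp add: avg_def)

lemma avg_const:
  assumes "B \<in> fmeasurable \<mu>" "0 < measure \<mu> B"
  shows "avg \<mu> B (\<lambda>_. c) = c"
  using assms by (simp add: avg_def set_integral_const)

lemma avg_mono:
  assumes "set_integrable \<mu> B f" "set_integrable \<mu> B g" "\<And>y. y \<in> B \<Longrightarrow> f y \<le> g y"
  shows "avg \<mu> B f \<le> avg \<mu> B g"
  using assms by (simp add: avg_def divide_right_mono set_integral_mono)

lemma abs_avg_le:
  assumes "set_integrable \<mu> B f" "set_integrable \<mu> B g" "\<And>y. y \<in> B \<Longrightarrow> \<bar>f y\<bar> \<le> g y"
  shows "\<bar>avg \<mu> B f\<bar> \<le> avg \<mu> B g"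
proof -
  have "avg \<mu> B f \<le> avg \<mu> B g"
    using assms by (intro avg_mono) (auto simp: abs_le_iff)
  moreover have "avg \<mu> B (\<lambda>y. (-1) * f y) \<le> avg \<mu> B g"
    using assms by (intro avg_mono set_integrable_mult_right) (auto simp: abs_le_iff)
  ultimately show ?thesis
    unfolding avg_mult by simp
qed

lemma abs_avg_le_const:
  assumes "B \<in> fmeasurable \<mu>" "0 < measure \<mu> B" "set_integrable \<mu> B f" "\<And>y. y \<in> B \<Longrightarrow> \<bar>f y\<bar> \<le> c"
  shows "\<bar>avg \<mu> B f\<bar> \<le> c"
  using abs_avg_le[OF assms(3) set_integrable_const[OF assms(1), of c]] assms(4)
  by (simp add: avg_const[OF assms(1,2)])

section \<open>Reflection invariance and averages of odd functions\<close>

definition symmetric_body :: "'a::euclidean_space set \<Rightarrow> 'a \<Rightarrow> bool" where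
  "symmetric_body B x \<longleftrightarrow>
     B \<in> lmeasurable \<and> 0 < measure lebesgue B \<and> (\<forall>v. x + v \<in> B \<longleftrightarrow> x - v \<in> B)"

text \<open>A point reflection is affine with every coordinate scaled by -1, so its Jacobian factor
  is a product of ones and Lebesgue measure is preserved.\<close>

lemma lebesgue_integral_reflect:
  fixes f :: "'a::euclidean_space \<Rightarrow> real"
  assumes "f \<in> borel_measurable lebesgue"
  shows "(LINT y|lebesgue. f (c - y)) = (LINT y|lebesgue. f y)"
proof -
  have eq: "(\<lambda>y::'a. c + (\<Sum>j\<in>Basis. ((-1) * (y \<bullet> j)) *\<^sub>R j)) = (\<lambda>y. c - y)"
    by (simp add: sum_negf euclidean_representation)
  have meas: "(\<lambda>y::'a. c - y) \<in> lebesgue \<rightarrow>\<^sub>M lebesgue"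
    using lebesgue_affine_measurable[where c = "\<lambda>_. -1" and t = c] unfolding eq by simp
  have "lebesgue = density (distr lebesgue lebesgue (\<lambda>y::'a. c - y)) (\<lambda>_. ennreal (\<Prod>j\<in>(Basis::'a set). \<bar>-1::real\<bar>))"
    using lebesgue_affine_euclidean[where c = "\<lambda>_. -1" and t = c] unfolding eq by simp
  then have "lebesgue = distr lebesgue lebesgue (\<lambda>y::'a. c - y)"
    by (simp add: density_1)
  then have "(LINT y|lebesgue. f y) = (LINT y|distr lebesgue lebesgue (\<lambda>y. c - y). f y)"
    by simp
  also have "\<dots> = (LINT y|lebesgue. f (c - y))"
    using meas assms by (rule integral_distr)
  finally show ?thesis by simp
qed

lemma continuous_on_linear_shift:
  fixes l :: "'a::euclidean_space \<Rightarrow> 'b::real_normed_vector"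
  assumes "linear l"
  shows "continuous_on UNIV (\<lambda>y. l (y - x))"
  using linear_continuous_on[of l UNIV] assms continuous_on_compose2[of UNIV l UNIV "\<lambda>y. y - x"]
  by (simp add: linear_conv_bounded_linear continuous_on_diff)

text \<open>The reflection in \<open>x\<close> maps \<open>B\<close> to itself and changes the sign
  of the integrand, so the integral equals its own negative. A non-integrable integrand is covered
  too, its integral being 0 by convention.\<close>

lemma avg_odd:
  fixes l :: "'a::euclidean_space \<Rightarrow> real"
  assumes "symmetric_body B x" and "linear l"
  shows "avg lebesgue B (\<lambda>y. l (y - x)) = 0"
proof -
  have sym: "2 *\<^sub>R x - y \<in> B \<longleftrightarrow> y \<in> B" for y
    using assms(1) unfolding symmetric_body_def
    by (metis (no_types, lifting) add_diff_cancel_left' diff_add_cancel diff_diff_eq2 scaleR_2 add_diff_eq)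
  let ?g = "\<lambda>y. indicator B y * l (y - x)"
  have [measurable]: "B \<in> sets lebesgue"
    using assms(1) by (auto simp: symmetric_body_def)
  have "continuous_on UNIV (\<lambda>y. l (y - x))"
    using assms(2) by (rule continuous_on_linear_shift)
  then have [measurable]: "(\<lambda>y. l (y - x)) \<in> borel_measurable lebesgue"
    using continuous_imp_measurable_on_sets_lebesgue[of UNIV "\<lambda>y. l (y - x)"] by simp
  have "(LINT y|lebesgue. ?g y) = (LINT y|lebesgue. ?g (2 *\<^sub>R x - y))"
    by (rule lebesgue_integral_reflect[symmetric]) measurable
  also have "\<dots> = (LINT y|lebesgue. - ?g y)"
  proof (rule Bochner_Integration.integral_cong[OF refl])
    fix y
    have "2 *\<^sub>R x - y - x = - (y - x)"
      by (simp add: scaleR_2)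
    then have "l (2 *\<^sub>R x - y - x) = - l (y - x)"
      by (metis linear_neg[OF assms(2)])
    then show "?g (2 *\<^sub>R x - y) = - ?g y"
      using sym[of y] by (simp add: indicator_def)
  qed
  also have "\<dots> = - (LINT y|lebesgue. ?g y)"
    by simp
  finally have "(LINT y|lebesgue. ?g y) = 0"
    by linarith
  then show ?thesis
    by (simp add: avg_def set_lebesgue_integral_def)
qed

lemma set_borel_measurable_continuous:
  fixes f :: "'a::euclidean_space \<Rightarrow> real"
  assumes "open S" "continuous_on S f" "B \<in> sets lebesgue" "B \<subseteq> S"
  shows "set_borel_measurable lebesgue B f"
proof -
  have "f \<in> borel_measurable (lebesgue_on S)"
    using assms by (intro continuous_imp_measurable_on_sets_lebesgue) auto
  then have "set_borel_measurable lebesgue S f"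
    using assms(1) by (auto simp: set_borel_measurable_def borel_measurable_restrict_space_iff)
  then show ?thesis
    by (rule set_borel_measurable_subset) (use assms in auto)
qed

lemma avg_sum:
  assumes "finite I" "\<And>i. i \<in> I \<Longrightarrow> set_integrable \<mu> B (f i)"
  shows "avg \<mu> B (\<lambda>y. \<Sum>i\<in>I. f i y) = (\<Sum>i\<in>I. avg \<mu> B (f i))"
proof -
  have "set_integrable \<mu> B (\<lambda>y. \<Sum>i\<in>J. f i y) \<and>
      avg \<mu> B (\<lambda>y. \<Sum>i\<in>J. f i y) = (\<Sum>i\<in>J. avg \<mu> B (f i))" if "J \<subseteq> I" for J
    using finite_subset[OF that assms(1)] that
  proof (induction J rule: finite_induct)
    case empty
    then show ?case by (simp add: set_integrable_def avg_def)
  next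
    case (insert j J)
    then show ?case using assms(2) by (auto simp: avg_add)
  qed
  then show ?thesis by blast
qed

text \<open>Converts Landau statements at \<open>nhds x\<close> into bounds on a whole shrinking
  ball for all small \<open>r\<close>; this is how containment in \<open>cball x (C * r)\<close> is
  exploited.\<close>

lemma eventually_cball_subset:
  fixes x :: "'a::real_normed_vector"
  assumes "eventually P (nhds x)"
  shows "\<forall>\<^sub>F r in at_right (0::real). \<forall>y\<in>cball x (C * r). P y"
proof -
  obtain e where e: "e > 0" "\<And>y. dist y x < e \<Longrightarrow> P y"
    using assms unfolding eventually_nhds_metric by blast
  have "((\<lambda>r. C * r) \<longlongrightarrow> C * 0) (at_right 0)"
    by (intro tendsto_intros)
  then have "\<forall>\<^sub>F r in at_right 0. C * r < e"
    using e(1) by (intro order_tendstoD) auto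
  then show ?thesis
    by eventually_elim (use e(2) in \<open>auto simp: dist_commute\<close>)
qed

lemma set_integrable_continuous_bounded:
  fixes f :: "'a::euclidean_space \<Rightarrow> real"
  assumes "B \<in> lmeasurable" "bounded B" "continuous_on UNIV f"
  shows "set_integrable lebesgue B f"
proof -
  have "compact (closure B)"
    using assms(2) by simp
  then have "bounded (f ` closure B)"
    using assms(3) by (intro compact_imp_bounded compact_continuous_image)
      (auto intro: continuous_on_subset)
  then obtain c where "\<And>y. y \<in> closure B \<Longrightarrow> \<bar>f y\<bar> \<le> c"
    unfolding bounded_iff by auto
  then have "\<And>y. y \<in> B \<Longrightarrow> \<bar>f y\<bar> \<le> c"
    using closure_subset by blast
  then show ?thesis
    using assms by (intro set_integrable_bounded set_borel_measurable_continuous[of UNIV]) auto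
qed

section \<open>The moment matrix and second-order limits of averages\<close>

lemma moment_matrix_sym: "moment_matrix d r x $ i $ j = moment_matrix d r x $ j $ i"
  by (simp add: moment_matrix_def mult.commute)

text \<open>Expanding the form entrywise leaves averages of coordinate products, which are the
  moments up to the factor \<open>r^2\<close>. Boundedness of the ball makes each product
  integrable, so averaging may be done termwise.\<close>

lemma avg_quadratic_form:
  fixes x :: "real^'n"
  assumes "dball UNIV d x r \<in> lmeasurable" "bounded (dball UNIV d x r)"
  shows "1 / r\<^sup>2 * avg lebesgue (dball UNIV d x r) (\<lambda>y. (y - x) \<bullet> (Q *v (y - x))) =
     trace (moment_matrix d r x ** Q)"
proof -
  let ?B = "dball UNIV d x r"
  have int: "set_integrable lebesgue ?B (\<lambda>y. Q $ i $ j * ((y - x) $ i * (y - x) $ j))" for i j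
    by (intro set_integrable_continuous_bounded assms continuous_intros)
  have "avg lebesgue ?B (\<lambda>y. (y - x) \<bullet> (Q *v (y - x))) =
      avg lebesgue ?B (\<lambda>y. \<Sum>p\<in>UNIV. Q $ fst p $ snd p * ((y - x) $ fst p * (y - x) $ snd p))"
    by (rule arg_cong[where f = "avg lebesgue ?B"], rule ext)
      (simp add: inner_vec_def matrix_vector_mult_def sum_distrib_left sum.cartesian_product
        case_prod_beta mult_ac flip: UNIV_Times_UNIV)
  also have "\<dots> = (\<Sum>p\<in>UNIV. Q $ fst p $ snd p * avg lebesgue ?B (\<lambda>y. (y - x) $ fst p * (y - x) $ snd p))"
    by (subst avg_sum) (simp_all only: int finite avg_mult)
  finally have "1 / r\<^sup>2 * avg lebesgue ?B (\<lambda>y. (y - x) \<bullet> (Q *v (y - x))) =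
      (\<Sum>p\<in>UNIV. Q $ fst p $ snd p * moment_matrix d r x $ snd p $ fst p)"
    by (simp add: sum_distrib_left moment_matrix_def mult_ac)
  also have "\<dots> = (\<Sum>i\<in>UNIV. \<Sum>j\<in>UNIV. moment_matrix d r x $ j $ i * Q $ i $ j)"
    by (simp add: sum.cartesian_product case_prod_beta mult_ac flip: UNIV_Times_UNIV)
  also have "\<dots> = trace (moment_matrix d r x ** Q)"
    by (subst sum.swap) (simp add: trace_def matrix_matrix_mult_def)
  finally show ?thesis .
qed

lemma tendsto_trace_mult:
  fixes A :: "'a \<Rightarrow> real^'n^'n"
  assumes "(A \<longlongrightarrow> M) F"
  shows "((\<lambda>r. trace (A r ** Q)) \<longlongrightarrow> trace (M ** Q)) F"
  unfolding trace_def matrix_matrix_mult_def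
  using assms by (auto intro!: tendsto_intros)

text \<open>The linear part averages to 0, the quadratic part is a trace against the moment matrix,
  and the remainder is \<open>o(r^2)\<close> on a ball of Euclidean radius \<open>C * r\<close>.
  Used with \<open>w * (u - u x)\<close> for the AMV limit and with \<open>u - u x\<close> for the
  symmetrized term.\<close>

lemma avg_second_order_limit:
  fixes x :: "real^'n"
  assumes C: "0 < C"
    and bodies: "\<forall>\<^sub>F r in at_right 0. symmetric_body (dball UNIV d x r) x \<and>
      dball UNIV d x r \<subseteq> cball x (C * r)"
    and M: "((\<lambda>r. moment_matrix d r x) \<longlongrightarrow> M) (at_right 0)"
    and l: "linear l"
    and expand: "(\<lambda>y. f y - l (y - x) - (y - x) \<bullet> (Q *v (y - x))) \<in> o[nhds x](\<lambda>y. (norm (y - x))\<^sup>2)"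
    and meas: "\<forall>\<^sub>F r in at_right 0. set_borel_measurable lebesgue (dball UNIV d x r) f"
  shows "\<forall>\<^sub>F r in at_right 0. set_integrable lebesgue (dball UNIV d x r) f"
    and "((\<lambda>r. 1 / r\<^sup>2 * avg lebesgue (dball UNIV d x r) f) \<longlongrightarrow> trace (M ** Q)) (at_right 0)"
proof -
  let ?B = "\<lambda>r. dball UNIV d x r"
  let ?l = "\<lambda>y. l (y - x)" and ?q = "\<lambda>y. (y - x) \<bullet> (Q *v (y - x))"
  let ?e = "\<lambda>y. f y - ?l y - ?q y"
  have cl: "continuous_on UNIV ?l"
    using l by (rule continuous_on_linear_shift)
  have cq: "continuous_on UNIV ?q"
    by (intro continuous_intros continuous_on_linear_shift) simp
  have small: "\<forall>\<^sub>F r in at_right 0. set_integrable lebesgue (?B r) ?l \<and> set_integrable lebesgue (?B r) ?q \<and>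
      set_integrable lebesgue (?B r) ?e \<and> \<bar>1 / r\<^sup>2 * avg lebesgue (?B r) ?e\<bar> \<le> \<epsilon>" if "\<epsilon> > 0" for \<epsilon>
  proof -
    \<comment> \<open>On the ball \<open>norm (y - x)\<close> is at most \<open>C * r\<close>, so
      this constant yields the remainder bound \<open>\<epsilon> * r\<^sup>2\<close>.\<close>
    have "\<epsilon> / C\<^sup>2 > 0"
      using that C by simp
    from landau_o.smallD[OF expand this]
    have "\<forall>\<^sub>F r in at_right 0. \<forall>y\<in>cball x (C * r). \<bar>?e y\<bar> \<le> \<epsilon> / C\<^sup>2 * (norm (y - x))\<^sup>2"
      by (intro eventually_cball_subset) simp
    with bodies meas eventually_at_right_less[of 0] show ?thesis
    proof eventually_elim
      case (elim r)
      have B: "?B r \<in> lmeasurable" "0 < measure lebesgue (?B r)" "bounded (?B r)" "?B r \<subseteq> cball x (C * r)"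
        using elim bounded_subset[OF bounded_cball] by (auto simp: symmetric_body_def)
      have int: "set_integrable lebesgue (?B r) ?l" "set_integrable lebesgue (?B r) ?q"
        by (intro set_integrable_continuous_bounded B cl cq)+
      have bound: "\<bar>?e y\<bar> \<le> \<epsilon> * r\<^sup>2" if y: "y \<in> ?B r" for y
      proof -
        have "norm (y - x) \<le> C * r"
          using y B(4) by (auto simp: dist_norm norm_minus_commute)
        then have "(norm (y - x))\<^sup>2 \<le> C\<^sup>2 * r\<^sup>2"
          by (metis norm_ge_zero power_mono power_mult_distrib)
        then have "\<epsilon> / C\<^sup>2 * (norm (y - x))\<^sup>2 \<le> \<epsilon> / C\<^sup>2 * (C\<^sup>2 * r\<^sup>2)"
          using \<open>\<epsilon> > 0\<close> by (intro mult_left_mono) auto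
        also have "\<dots> = \<epsilon> * r\<^sup>2"
          using C by simp
        finally show ?thesis
          using elim(4) y B(4) by fastforce
      qed
      have "set_borel_measurable lebesgue (?B r) ?l" "set_borel_measurable lebesgue (?B r) ?q"
        using int by (auto simp: set_borel_measurable_def set_integrable_def)
      then have "set_borel_measurable lebesgue (?B r) ?e"
        using elim(2) by (simp add: set_borel_measurable_def right_diff_distrib)
      then have inte: "set_integrable lebesgue (?B r) ?e"
        using B(1) bound by (intro set_integrable_bounded)
      have "\<bar>avg lebesgue (?B r) ?e\<bar> \<le> \<epsilon> * r\<^sup>2"
        using B(1,2) inte bound by (rule abs_avg_le_const)
      then have "\<bar>1 / r\<^sup>2 * avg lebesgue (?B r) ?e\<bar> \<le> \<epsilon>"
        using elim by (simp add: abs_mult divide_simps)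
      with int inte show ?case by simp
    qed
  qed
  have fe: "f = (\<lambda>y. ?l y + (?q y + ?e y))"
    by auto
  show "\<forall>\<^sub>F r in at_right 0. set_integrable lebesgue (?B r) f"
    using small[OF zero_less_one]
    by eventually_elim (subst fe, intro set_integral_add, auto)
  have avg_e: "\<forall>\<^sub>F r in at_right 0. \<bar>1 / r\<^sup>2 * avg lebesgue (?B r) ?e\<bar> \<le> \<epsilon>" if "\<epsilon> > 0" for \<epsilon>
    using small[OF that] by eventually_elim simp
  have e0: "((\<lambda>r. 1 / r\<^sup>2 * avg lebesgue (?B r) ?e) \<longlongrightarrow> 0) (at_right 0)"
    by (intro tendsto_zero_abs_leI avg_e)
  have "\<forall>\<^sub>F r in at_right 0. trace (moment_matrix d r x ** Q) + 1 / r\<^sup>2 * avg lebesgue (?B r) ?e =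
      1 / r\<^sup>2 * avg lebesgue (?B r) f"
    using bodies small[OF zero_less_one]
  proof eventually_elim
    case (elim r)
    have B: "?B r \<in> lmeasurable" "bounded (?B r)"
      using elim bounded_subset[OF bounded_cball] by (auto simp: symmetric_body_def)
    have int: "set_integrable lebesgue (?B r) ?l" "set_integrable lebesgue (?B r) ?q"
      "set_integrable lebesgue (?B r) ?e"
      using elim by blast+
    have "avg lebesgue (?B r) f = avg lebesgue (?B r) ?l + avg lebesgue (?B r) (\<lambda>y. ?q y + ?e y)"
      by (subst fe) (rule avg_add[OF int(1) set_integral_add(1)[OF int(2,3)]])
    also have "avg lebesgue (?B r) ?l = 0"
      using elim by (intro avg_odd l) auto
    also have "avg lebesgue (?B r) (\<lambda>y. ?q y + ?e y) = avg lebesgue (?B r) ?q + avg lebesgue (?B r) ?e"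
      by (rule avg_add[OF int(2,3)])
    finally show ?case
      using avg_quadratic_form[OF B, of Q] by (simp add: ring_distribs)
  qed
  moreover have "((\<lambda>r. trace (moment_matrix d r x ** Q) + 1 / r\<^sup>2 * avg lebesgue (?B r) ?e)
      \<longlongrightarrow> trace (M ** Q) + 0) (at_right 0)"
    by (intro tendsto_add tendsto_trace_mult M e0)
  ultimately show "((\<lambda>r. 1 / r\<^sup>2 * avg lebesgue (?B r) f) \<longlongrightarrow> trace (M ** Q)) (at_right 0)"
    by (simp add: tendsto_cong)
qed

section \<open>Symmetric balls are comparable to Euclidean balls\<close>

text \<open>Ball symmetry without reference to \<open>\<Omega>\<close>: the condition
  \<open>d x y + r \<le> R\<close> places the ball around \<open>y\<close> inside the ball of radius
  \<open>R\<close> around \<open>x\<close>. One implication is enough, as \<open>v\<close> may be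
  replaced by \<open>- v\<close>.\<close>

locale symmetric_metric = Metric_space UNIV d
  for d :: "'a::euclidean_space \<Rightarrow> 'a \<Rightarrow> real" +
  fixes x :: 'a and R :: real
  assumes symmetric_near: "\<And>y v r. \<lbrakk>d x y + r \<le> R; d y (y + v) < r\<rbrakk> \<Longrightarrow> d y (y - v) < r"
begin

text \<open>Symmetry concerns open balls, so it is applied with radii slightly larger than
  \<open>d y z\<close>, and the excess tends to 0.\<close>

lemma reflection_le:
  assumes "d x y + d y z < R"
  shows "d y (2 *\<^sub>R y - z) \<le> d y z"
proof (rule field_le_epsilon)
  fix e :: real
  assume "e > 0"
  \<comment> \<open>The excess is capped so that the enlarged radius still respects
    \<open>R\<close>.\<close>
  define e' where "e' = min e (R - (d x y + d y z))"
  have "e' > 0" "d x y + (d y z + e') \<le> R"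
    using \<open>e > 0\<close> assms by (auto simp: e'_def)
  then have "d y (y - (z - y)) < d y z + e'"
    by (intro symmetric_near) auto
  moreover have "y - (z - y) = 2 *\<^sub>R y - z"
    by (simp add: scaleR_2)
  ultimately show "d y (2 *\<^sub>R y - z) \<le> d y z + e"
    unfolding e'_def by auto
qed

text \<open>The composition of the reflections in \<open>x\<close> and in \<open>x + v\<close> is the translation by \<open>2v\<close>.\<close>

lemma translation_le:
  assumes "d x (x + v) \<le> r" "d x z \<le> s" "s + 2 * r < R"
  shows "d x (z + 2 *\<^sub>R v) \<le> s + 2 * r"
proof -
  have r: "0 \<le> r"
    using assms(1) nonneg[of x "x + v"] by linarith
  have 1: "d x (2 *\<^sub>R x - z) \<le> s"
    using assms r by (intro order_trans[OF reflection_le]) auto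
  \<comment> \<open>Reflections do not increase the distance to their centre; only the two changes
    of centre, from \<open>x\<close> to \<open>x + v\<close> and back, cost \<open>r\<close>
    each.\<close>
  have 2: "d (x + v) (2 *\<^sub>R x - z) \<le> r + s"
    using triangle[of "x + v" x "2 *\<^sub>R x - z"] 1 assms(1) commute[of "x + v" x] by simp
  have "2 *\<^sub>R (x + v) - (2 *\<^sub>R x - z) = z + 2 *\<^sub>R v"
    by (simp add: algebra_simps)
  with 2 have "d (x + v) (z + 2 *\<^sub>R v) \<le> r + s"
    using reflection_le[of "x + v" "2 *\<^sub>R x - z"] assms by (simp add: algebra_simps)
  then show ?thesis
    using triangle[of x "x + v" "z + 2 *\<^sub>R v"] assms(1) by simp
qed

text \<open>Reflecting one point of the progression in the next gives the one after it, so
  consecutive \<open>d\<close>-steps do not grow and the triangle inequality adds up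
  \<open>k\<close> of them. This takes the place of translation invariance of
  \<open>d\<close>.\<close>

lemma iterated_translation_le:
  assumes "d x y + real k * d y (y + v) < R"
  shows "d y (y + real k *\<^sub>R v) \<le> real k * d y (y + v)"
proof -
  let ?t = "d y (y + v)" and ?p = "\<lambda>j::nat. y + real j *\<^sub>R v"
  \<comment> \<open>The length of the last step is carried along because the next reflection
    reproduces it; at \<open>j = 0\<close> there is no such step.\<close>
  have "j \<le> k \<Longrightarrow> d y (?p j) \<le> real j * ?t \<and> (0 < j \<longrightarrow> d (?p (j - 1)) (?p j) \<le> ?t)" for j
  proof (induction j)
    case (Suc j)
    show ?case
    proof (cases "j = 0")
      case False
      then have IH: "d y (?p j) \<le> real j * ?t" "d (?p (j - 1)) (?p j) \<le> ?t"
        using Suc by auto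
      \<comment> \<open>The reflection needs room for one more step, available because
        \<open>Suc j \<le> k\<close>.\<close>
      have "real (Suc j) * ?t \<le> real k * ?t"
        using Suc.prems by (intro mult_right_mono) auto
      moreover have "d x (?p j) \<le> d x y + d y (?p j)"
        using triangle[of x y "?p j"] by simp
      ultimately have "d x (?p j) + d (?p j) (?p (j - 1)) < R"
        using IH assms by (auto simp: algebra_simps commute)
      from reflection_le[OF this] IH(2)
      have "d (?p j) (2 *\<^sub>R ?p j - ?p (j - 1)) \<le> ?t"
        by (simp add: commute)
      moreover have "2 *\<^sub>R ?p j - ?p (j - 1) = ?p (Suc j)"
      proof -
        have "?p (Suc j) = ?p j + v"
          by (simp add: scaleR_left.add)
        moreover have "?p j = ?p (j - 1) + v"
          using False scaleR_left.add[of "real (j - 1)" 1 v] by (simp add: of_nat_diff)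
        ultimately show ?thesis
          by (simp add: scaleR_2)
      qed
      ultimately have "d (?p j) (?p (Suc j)) \<le> ?t"
        by simp
      moreover have "d y (?p (Suc j)) \<le> d y (?p j) + d (?p j) (?p (Suc j))"
        using triangle by simp
      ultimately show ?thesis
        using IH(1) by (simp add: algebra_simps)
    qed auto
  qed auto
  then show ?thesis by blast
qed

text \<open>With \<open>t = d y z\<close>, the step from \<open>y\<close> to \<open>z\<close> is
  repeated about \<open>r0 / (2 * t)\<close> times. The progression stays in the
  \<open>d\<close>-ball of radius \<open>r0\<close>, hence within Euclidean distance
  \<open>\<rho>\<close> of \<open>x\<close>, so \<open>k * norm (z - y)\<close> is at most
  \<open>2 * \<rho>\<close>; dividing by \<open>k\<close> gives a bound linear in
  \<open>t\<close>.\<close>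

lemma norm_le_dist:
  assumes bounded: "\<And>z. d x z < r0 \<Longrightarrow> norm (z - x) \<le> \<rho>"
    and r0: "0 < r0" "r0 \<le> R" and y: "d x y < r0 / 2" and z: "d y z < r0 / 4"
  shows "norm (z - y) \<le> 8 * \<rho> / r0 * d y z"
proof (cases "z = y")
  case False
  define t where "t = d y z"
  have t: "0 < t" "t < r0 / 4"
    using False z by (auto simp: t_def)
  \<comment> \<open>The largest integer strictly below \<open>r0 / (2 * t)\<close>. Strictness keeps
    \<open>k * t < r0 / 2\<close>; as the quotient exceeds 2, subtracting 1 costs at most a factor
    2. Combined with \<open>2 * \<rho>\<close> this produces the 8.\<close>
  define k where "k = nat (\<lceil>r0 / (2 * t)\<rceil> - 1)"
  have "2 < r0 / (2 * t)"
    using t by (simp add: field_simps)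
  then have "real k = real_of_int \<lceil>r0 / (2 * t)\<rceil> - 1"
    unfolding k_def by (subst of_nat_nat) linarith+
  then have k: "real k < r0 / (2 * t)" "r0 / (2 * t) \<le> real k + 1"
    by linarith+
  then have k1: "real k * t < r0 / 2" "r0 / (4 * t) \<le> real k"
    using t by (simp_all add: field_simps)
  let ?v = "z - y"
  have v: "d y (y + ?v) = t"
    by (simp add: t_def)
  have "d y (y + real k *\<^sub>R ?v) \<le> real k * t"
    using iterated_translation_le[of y k ?v] k1 y r0 unfolding v by simp
  then have "d x (y + real k *\<^sub>R ?v) < r0"
    using triangle[of x y "y + real k *\<^sub>R ?v"] k1 y by simp
  then have "norm (y + real k *\<^sub>R ?v - x) \<le> \<rho>"
    by (rule bounded)
  moreover have "norm (y - x) \<le> \<rho>"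
    using bounded y r0 by simp
  moreover have "real k *\<^sub>R ?v = (y + real k *\<^sub>R ?v - x) - (y - x)"
    by simp
  ultimately have "norm (real k *\<^sub>R ?v) \<le> 2 * \<rho>"
    using norm_triangle_ineq4[of "y + real k *\<^sub>R ?v - x" "y - x"] by simp
  then have "real k * norm ?v \<le> 2 * \<rho>"
    by simp
  moreover have "r0 / (4 * t) * norm ?v \<le> real k * norm ?v"
    using k1 by (intro mult_right_mono) auto
  ultimately have "r0 / (4 * t) * norm ?v \<le> 2 * \<rho>"
    by linarith
  then show ?thesis
    using t r0 unfolding t_def[symmetric] by (simp add: field_simps)
qed simp

text \<open>If a point \<open>x + v\<close> of a small ball were far from \<open>x\<close>, the translation by \<open>2v\<close> would move a part of
  definite measure of a ball into the tail of a ball of finite measure.\<close>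

lemma ball_bounded:
  assumes R: "0 < R"
    and fin: "mball x R \<in> lmeasurable"
    and meas: "mball x (R / 4) \<in> sets lebesgue" "0 < emeasure lebesgue (mball x (R / 4))"
  obtains \<rho> where "0 < \<rho>" "\<And>z. d x z < R / 4 \<Longrightarrow> norm (z - x) \<le> \<rho>"
proof -
  let ?S = "mball x (R / 4)" and ?T = "mball x R"
  have UN: "(\<Union>n. A \<inter> cball x (real n)) = A" for A
    by (auto simp: real_arch_simple)
  have inc: "incseq (\<lambda>n. A \<inter> cball x (real n))" for A
    by (auto simp: incseq_def)
  have lim: "(\<lambda>n. measure lebesgue (A \<inter> cball x (real n))) \<longlonglongrightarrow> measure lebesgue A"
    if "A \<in> lmeasurable" for A
  proof -
    have "range (\<lambda>n. A \<inter> cball x (real n)) \<subseteq> sets lebesgue" "emeasure lebesgue A \<noteq> \<infinity>"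
      using that by (auto simp: fmeasurable_def)
    then show ?thesis
      using Lim_measure_incseq[of "\<lambda>n. A \<inter> cball x (real n)" lebesgue] inc[of A] unfolding UN by blast
  qed
  have sub: "?S \<subseteq> ?T"
    using R by auto
  have S: "?S \<in> lmeasurable"
    using fmeasurableI2[OF fin sub meas(1)] .
  then have "0 < measure lebesgue ?S"
    using meas(2) by (simp add: emeasure_eq_measure2)
  from order_tendstoD(1)[OF lim[OF S] this]
  obtain m where m: "0 < measure lebesgue (?S \<inter> cball x (real m))"
    by (auto simp: eventually_sequentially)
  \<comment> \<open>A bounded piece of positive measure, so that a long translation carries all of
    it far away.\<close>
  define A where "A = ?S \<inter> cball x (real m)"
  have A: "A \<in> lmeasurable" "0 < measure lebesgue A"
    using S m by (auto simp: A_def intro: fmeasurable_Int_fmeasurable)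
  \<comment> \<open>\<open>n\<close> is taken so large that the part of \<open>?T\<close> outside
    \<open>cball x n\<close> has smaller measure than \<open>A\<close>.\<close>
  have "measure lebesgue ?T - measure lebesgue A < measure lebesgue ?T"
    using A by simp
  from order_tendstoD(1)[OF lim[OF fin] this]
  obtain n where n: "measure lebesgue ?T - measure lebesgue A < measure lebesgue (?T \<inter> cball x (real n))"
    by (auto simp: eventually_sequentially)
  \<comment> \<open>Points of \<open>A\<close> are within \<open>m\<close> of \<open>x\<close>;
    after translation by \<open>2v\<close> with \<open>norm v > m + n + 1\<close> they are farther
    than \<open>n\<close> from \<open>x\<close>.\<close>
  have "norm (z - x) \<le> real m + real n + 1" if z: "d x z < R / 4" for z
  proof (rule ccontr)
    assume far: "\<not> norm (z - x) \<le> real m + real n + 1"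
    define v where "v = z - x"
    let ?A' = "(+) (2 *\<^sub>R v) ` A"
    have "?A' \<subseteq> ?T"
    proof
      fix b assume "b \<in> ?A'"
      then obtain a where a: "a \<in> A" "b = a + 2 *\<^sub>R v"
        by (auto simp: add.commute)
      then have "d x a < R / 4"
        by (auto simp: A_def)
      \<comment> \<open>Since \<open>d x z < R / 4\<close>, the bound is below
        \<open>3 * R / 4\<close>, so the translate stays in the ball of radius
        \<open>R\<close>.\<close>
      then have "d x b \<le> R / 4 + 2 * d x z" 
        unfolding a by (intro translation_le) (use z R in \<open>auto simp: v_def\<close>)
      then show "b \<in> ?T"
        using z R by simp
    qed
    moreover have "b \<notin> cball x (real n)" if b: "b \<in> ?A'" for b
    proof -
      obtain a where a: "a \<in> A" "b = a + 2 *\<^sub>R v"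
        using b by (auto simp: add.commute)
      have "norm (a - x) \<le> real m"
        using a by (auto simp: A_def dist_norm norm_minus_commute)
      moreover have "2 *\<^sub>R v = (b - x) - (a - x)"
        using a by simp
      then have "2 * norm v \<le> norm (b - x) + norm (a - x)"
        using norm_triangle_ineq4[of "b - x" "a - x"] by (metis norm_scaleR abs_numeral)
      ultimately show ?thesis
        using far by (auto simp: v_def dist_norm norm_minus_commute)
    qed
    ultimately have "?A' \<subseteq> ?T" "?A' \<inter> (?T \<inter> cball x (real n)) = {}"
      by auto
    moreover have A': "?A' \<in> lmeasurable" "measure lebesgue ?A' = measure lebesgue A"
      using A by (auto simp: measurable_translation measure_translation)
    moreover have Tn: "?T \<inter> cball x (real n) \<in> lmeasurable"
      using fin by (intro fmeasurable_Int_fmeasurable) auto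
    ultimately have "measure lebesgue A + measure lebesgue (?T \<inter> cball x (real n)) =
        measure lebesgue (?A' \<union> ?T \<inter> cball x (real n))"
      by (subst measure_Un3) auto
    also have "\<dots> \<le> measure lebesgue ?T"
      using \<open>?A' \<subseteq> ?T\<close> A' Tn fin by (intro measure_mono_fmeasurable) auto
    finally show False
      using n by simp
  qed
  then show ?thesis
    using that[of "real m + real n + 1"] by simp
qed

end

section \<open>Second-order expansions\<close>

lemma has_derivative_gradient:
  fixes f :: "real^'n \<Rightarrow> real"
  assumes "f differentiable (at x)"
  shows "(f has_derivative (\<lambda>v. gradient f x \<bullet> v)) (at x)"
proof -
  let ?f' = "frechet_derivative f (at x)"
  have lin: "linear ?f'"
    using assms by (simp add: linear_frechet_derivative)
  have "?f' v = gradient f x \<bullet> v" for v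
  proof -
    have "?f' v = ?f' (\<Sum>i\<in>UNIV. v $ i *\<^sub>R axis i 1)"
      by (simp add: basis_expansion flip: scalar_mult_eq_scaleR)
    also have "\<dots> = gradient f x \<bullet> v"
      by (simp add: linear_sum[OF lin] linear_cmul[OF lin] gradient_def inner_vec_def mult.commute)
    finally show ?thesis .
  qed
  then have "?f' = (\<lambda>v. gradient f x \<bullet> v)"
    by blast
  then show ?thesis
    using assms frechet_derivative_works by metis
qed

lemma has_derivative_hessian:
  assumes "gradient u differentiable (at x)"
  shows "(gradient u has_derivative (\<lambda>v. hessian u x *v v)) (at x)"
  using assms unfolding hessian_def by (simp add: jacobian_works)

text \<open>The mean value theorem along the segment from \<open>x\<close> to \<open>y\<close> only sees the quadratic form of the
  Hessian, so its symmetry is not required.\<close>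

lemma second_order_expansion:
  fixes u :: "real^'n \<Rightarrow> real"
  assumes "open \<Omega>" "x \<in> \<Omega>" "\<And>y. y \<in> \<Omega> \<Longrightarrow> u differentiable (at y)" "gradient u differentiable (at x)"
  shows "(\<lambda>y. u y - u x - gradient u x \<bullet> (y - x) - (y - x) \<bullet> (((1/2) *\<^sub>R hessian u x) *v (y - x)))
    \<in> o[nhds x](\<lambda>y. (norm (y - x))\<^sup>2)"
proof (rule landau_o.smallI)
  fix c :: real
  assume "c > 0"
  let ?H = "hessian u x"
  obtain d1 where d1: "d1 > 0" "\<And>y. norm (y - x) < d1 \<Longrightarrow>
      norm (gradient u y - gradient u x - ?H *v (y - x)) \<le> c * norm (y - x)"
    using has_derivative_hessian[OF assms(4)] \<open>c > 0\<close> unfolding has_derivative_at_alt by blast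
  obtain d2 where d2: "d2 > 0" "ball x d2 \<subseteq> \<Omega>"
    using assms(1,2) openE by blast
  have "norm (u y - u x - gradient u x \<bullet> (y - x) - (y - x) \<bullet> (((1/2) *\<^sub>R ?H) *v (y - x)))
      \<le> c * norm ((norm (y - x))\<^sup>2)" if y: "dist y x < min d1 d2" for y
  proof -
    define h where "h = y - x"
    \<comment> \<open>\<open>g\<close> is \<open>u\<close> along the segment minus its linear and
      quadratic terms. Its increment over the unit interval is the Taylor remainder, and
      \<open>?g'\<close> is the linearization error of the gradient paired with
      \<open>h\<close>.\<close>
    define g where "g t = u (x + t *\<^sub>R h) - t * (gradient u x \<bullet> h) - t\<^sup>2 / 2 * (h \<bullet> (?H *v h))" for t
    let ?g' = "\<lambda>t. gradient u (x + t *\<^sub>R h) \<bullet> h - gradient u x \<bullet> h - t * (h \<bullet> (?H *v h))"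
    have near: "norm (t *\<^sub>R h) < min d1 d2" if "0 \<le> t" "t \<le> 1" for t
    proof -
      have "norm (t *\<^sub>R h) \<le> 1 * norm h"
        unfolding norm_scaleR using that by (intro mult_right_mono) auto
      then show ?thesis
        using y by (simp add: h_def dist_norm)
    qed
    have der: "(g has_derivative (\<lambda>s. s * ?g' t)) (at t within {0..1})" if "0 \<le> t" "t \<le> 1" for t
    proof -
      have "x + t *\<^sub>R h \<in> \<Omega>"
        using near[OF that] d2(2) by (auto simp: dist_norm)
      note du = has_derivative_gradient[OF assms(3)[OF this]]
      have "((\<lambda>t. u (x + t *\<^sub>R h)) has_derivative (\<lambda>s. gradient u (x + t *\<^sub>R h) \<bullet> (s *\<^sub>R h)))
          (at t within {0..1})"
        by (rule has_derivative_compose[of "\<lambda>t. x + t *\<^sub>R h" "\<lambda>s. s *\<^sub>R h", OF _ du]) (auto intro!: derivative_eq_intros)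
      then show ?thesis
        unfolding g_def by (auto intro!: derivative_eq_intros simp: algebra_simps)
    qed
    have "\<exists>t\<in>{0<..<1}. g 1 - g 0 = (\<lambda>s. s * ?g' t) (1 - 0)"
      by (rule mvt_simple) (use der in auto)
    then obtain t where t: "0 < t" "t < 1" "g 1 - g 0 = ?g' t"
      by auto
    have "?g' t = (gradient u (x + t *\<^sub>R h) - gradient u x - ?H *v (t *\<^sub>R h)) \<bullet> h"
      by (simp add: inner_diff_left inner_diff_right matrix_vector_mult_scaleR inner_commute)
    then have "\<bar>?g' t\<bar> \<le> norm (gradient u (x + t *\<^sub>R h) - gradient u x - ?H *v (t *\<^sub>R h)) * norm h"
      by (simp add: Cauchy_Schwarz_ineq2)
    also have "\<dots> \<le> (c * norm (t *\<^sub>R h)) * norm h"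
      using d1(2)[of "x + t *\<^sub>R h"] near[of t] t by (intro mult_right_mono) auto
    also have "\<dots> \<le> (c * norm h) * norm h"
      using t \<open>c > 0\<close> by (intro mult_right_mono mult_left_mono) (auto simp: mult_left_le_one_le)
    finally have "\<bar>g 1 - g 0\<bar> \<le> c * (norm h)\<^sup>2"
      by (simp add: t(3) power2_eq_square)
    moreover have "g 1 - g 0 = u y - u x - gradient u x \<bullet> h - h \<bullet> (((1/2) *\<^sub>R ?H) *v h)"
      by (simp add: g_def h_def scaleR_matrix_vector_assoc[symmetric])
    ultimately show ?thesis
      by (simp add: h_def)
  qed
  then show "\<forall>\<^sub>F y in nhds x. norm (u y - u x - gradient u x \<bullet> (y - x) -
      (y - x) \<bullet> (((1/2) *\<^sub>R ?H) *v (y - x))) \<le> c * norm ((norm (y - x))\<^sup>2)"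
    unfolding eventually_nhds_metric using d1 d2 by (intro exI[of _ "min d1 d2"]) auto
qed

lemma first_order_expansion:
  fixes w :: "real^'n \<Rightarrow> real"
  assumes "w differentiable (at x)"
  shows "(\<lambda>y. w y - w x - gradient w x \<bullet> (y - x)) \<in> o[nhds x](\<lambda>y. norm (y - x))"
proof (rule landau_o.smallI)
  fix c :: real
  assume "c > 0"
  then show "\<forall>\<^sub>F y in nhds x. norm (w y - w x - gradient w x \<bullet> (y - x)) \<le> c * norm (norm (y - x))"
    using has_derivative_gradient[OF assms]
    unfolding has_derivative_at_alt eventually_nhds_metric by (auto simp: dist_norm)
qed

text \<open>Near \<open>x\<close> the gradient varies by at most \<open>\<epsilon>\<close>, and the
  mean value inequality on a convex ball bounds the linearization error at every centre
  \<open>y\<close>. Balls with moving centre require this uniformity.\<close>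

lemma first_order_expansion_uniform:
  fixes w :: "real^'n \<Rightarrow> real"
  assumes "open \<Omega>" "x \<in> \<Omega>" "C1_on \<Omega> w" "0 < \<epsilon>"
  obtains \<delta> where "0 < \<delta>"
    "\<And>y z. \<lbrakk>dist y x < \<delta>; dist z x < \<delta>\<rbrakk> \<Longrightarrow> \<bar>w z - w y - gradient w y \<bullet> (z - y)\<bar> \<le> \<epsilon> * norm (z - y)"
proof -
  have "isCont (gradient w) x"
    using assms by (auto simp: C1_on_def continuous_on_eq_continuous_at)
  then obtain d1 where d1: "d1 > 0" "\<And>y. dist y x < d1 \<Longrightarrow> dist (gradient w y) (gradient w x) < \<epsilon> / 2"
    using assms(4) unfolding continuous_at_eps_delta by (meson half_gt_zero)
  obtain d2 where d2: "d2 > 0" "ball x d2 \<subseteq> \<Omega>"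
    using assms(1,2) openE by blast
  define \<delta> where "\<delta> = min d1 d2"
  have "norm (w z - w y - gradient w y \<bullet> (z - y)) \<le> norm (z - y) * \<epsilon>"
    if yz: "dist y x < \<delta>" "dist z x < \<delta>" for y z
  proof (rule differentiable_bound_linearization[where S = "ball x \<delta>" and f' = "\<lambda>y v. gradient w y \<bullet> v"])
    show "y + t *\<^sub>R (z - y) \<in> ball x \<delta>" if "t \<in> {0..1}" for t
    proof -
      have "(1 - t) *\<^sub>R y + t *\<^sub>R z \<in> ball x \<delta>"
        using that yz by (intro convexD_alt[OF convex_ball]) (auto simp: dist_commute)
      then show ?thesis
        by (simp add: algebra_simps)
    qed
    show "(w has_derivative (\<lambda>v. gradient w y \<bullet> v)) (at y within ball x \<delta>)" if "y \<in> ball x \<delta>" for y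
    proof -
      have "y \<in> \<Omega>"
        using that d2(2) by (auto simp: \<delta>_def)
      then have "w differentiable (at y)"
        using assms(3) unfolding C1_on_def by blast
      then show ?thesis
        by (rule has_derivative_at_withinI[OF has_derivative_gradient])
    qed
    show "onorm ((\<lambda>v. gradient w p \<bullet> v) - (\<lambda>v. gradient w y \<bullet> v)) \<le> \<epsilon>" if p: "p \<in> ball x \<delta>" for p
    proof (rule onorm_le)
      fix v :: "real^'n"
      have "dist (gradient w p) (gradient w y) \<le> \<epsilon>"
        using dist_triangle2[of "gradient w p" "gradient w y" "gradient w x"]
          d1(2)[of p] d1(2)[of y] p yz by (simp add: \<delta>_def dist_commute)
      then have "norm (gradient w p - gradient w y) * norm v \<le> \<epsilon> * norm v"
        by (intro mult_right_mono) (auto simp: dist_norm)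
      then show "norm (((\<lambda>v. gradient w p \<bullet> v) - (\<lambda>v. gradient w y \<bullet> v)) v) \<le> \<epsilon> * norm v"
        using Cauchy_Schwarz_ineq2[of "gradient w p - gradient w y" v]
        by (simp add: inner_diff_left)
    qed
    show "y \<in> ball x \<delta>"
      using yz by (simp add: dist_commute)
  qed
  then show ?thesis
    using that[of \<delta>] d1 d2 by (auto simp: \<delta>_def mult.commute)
qed

section \<open>Growth bounds, trace identities and the expansion with weight\<close>

lemma inner_matrix_vector_bigo:
  fixes x :: "real^'n"
  shows "(\<lambda>y. (y - x) \<bullet> (Q *v (y - x))) \<in> O[F](\<lambda>y. (norm (y - x))\<^sup>2)"
proof (rule bigoI, intro always_eventually allI)
  fix y
  have "\<bar>(y - x) \<bullet> (Q *v (y - x))\<bar> \<le> norm (y - x) * norm (Q *v (y - x))"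
    by (rule Cauchy_Schwarz_ineq2)
  also have "\<dots> \<le> norm (y - x) * (onorm ((*v) Q) * norm (y - x))"
    by (intro mult_left_mono onorm) auto
  finally show "norm ((y - x) \<bullet> (Q *v (y - x))) \<le> onorm ((*v) Q) * norm ((norm (y - x))\<^sup>2)"
    by (simp add: power2_eq_square mult_ac)
qed

lemma inner_bigo: "(\<lambda>y. a \<bullet> (y - x)) \<in> O[F](\<lambda>y. norm (y - x))"
  by (rule bigoI[where c = "norm a"], intro always_eventually allI) (simp add: Cauchy_Schwarz_ineq2)

lemma outer_product_mult_vector: "outer_product a b *v h = (b \<bullet> h) *\<^sub>R a"
  for a b h :: "real^'n"
  by (simp add: vec_eq_iff inner_vec_def matrix_vector_mult_def outer_product_def sum_distrib_left
      sum_distrib_right mult_ac)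

lemma inner_outer_product: "h \<bullet> (outer_product a b *v h) = (a \<bullet> h) * (b \<bullet> h)"
  for a b h :: "real^'n"
  by (simp add: outer_product_mult_vector inner_commute)

lemma trace_mult_outer_product: "trace (M ** outer_product a b) = b \<bullet> (M *v a)"
  for a b :: "real^'n"
  by (simp add: trace_def matrix_matrix_mult_def inner_vec_def matrix_vector_mult_def outer_product_def
      sum_distrib_left mult_ac)

lemma matrix_mult_scaleR_right: "M ** (c *\<^sub>R A) = c *\<^sub>R (M ** A)" for M A :: "real^'n^'n"
  by (simp add: matrix_matrix_mult_def vec_eq_iff sum_distrib_left mult_ac)

lemma trace_scaleR: "trace (c *\<^sub>R A) = c * trace A" for A :: "real^'n^'n"
  by (simp add: trace_def sum_distrib_left)

text \<open>As \<open>u - u x\<close> vanishes at \<open>x\<close>, a first-order expansion of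
  \<open>w\<close> is enough. The product of the two linear parts is the quadratic form of the outer
  product; through it the gradient of \<open>w\<close> enters the AMV Laplacian.\<close>

lemma weighted_second_order_expansion:
  fixes u w :: "real^'n \<Rightarrow> real"
  assumes "open \<Omega>" "x \<in> \<Omega>" "\<And>y. y \<in> \<Omega> \<Longrightarrow> u differentiable (at y)" "gradient u differentiable (at x)"
    and "w differentiable (at x)"
  shows "(\<lambda>y. w y * (u y - u x) - (w x *\<^sub>R gradient u x) \<bullet> (y - x) -
      (y - x) \<bullet> (((w x / 2) *\<^sub>R hessian u x + outer_product (gradient u x) (gradient w x)) *v (y - x)))
    \<in> o[nhds x](\<lambda>y. (norm (y - x))\<^sup>2)"
proof -
  define q where "q y = (y - x) \<bullet> (((1/2) *\<^sub>R hessian u x) *v (y - x))" for y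
  define l where "l y = gradient u x \<bullet> (y - x)" for y
  define k where "k y = gradient w x \<bullet> (y - x)" for y
  have "(w \<longlongrightarrow> w x) (nhds x)"
    using differentiable_imp_continuous_within[OF assms(5)]
    by (simp add: continuous_within tendsto_at_iff_tendsto_nhds)
  then have w: "w \<in> O[nhds x](\<lambda>_. 1)" "(\<lambda>y. w y - w x) \<in> o[nhds x](\<lambda>_. 1)"
    by (auto intro!: bigoI_tendsto[where c = "w x"] smalloI_tendsto simp: LIM_zero)
  have 1: "(\<lambda>y. w y * (u y - u x - l y - q y)) \<in> o[nhds x](\<lambda>y. 1 * (norm (y - x))\<^sup>2)"
    unfolding l_def q_def using w(1) second_order_expansion[OF assms(1-4)] by (rule landau_o.big_small_mult)
  have 2: "(\<lambda>y. (w y - w x) * q y) \<in> o[nhds x](\<lambda>y. 1 * (norm (y - x))\<^sup>2)"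
    unfolding q_def using w(2) inner_matrix_vector_bigo by (rule landau_o.small_big_mult)
  have 3: "(\<lambda>y. l y * (w y - w x - k y)) \<in> o[nhds x](\<lambda>y. norm (y - x) * norm (y - x))"
    unfolding l_def k_def using inner_bigo first_order_expansion[OF assms(5)] by (rule landau_o.big_small_mult)
  \<comment> \<open>The three errors: \<open>w\<close> times the Taylor error of \<open>u\<close>,
    the variation of \<open>w\<close> times the quadratic term, and the linear term times the
    first-order error of \<open>w\<close>.\<close>
  have "(\<lambda>y. w y * (u y - u x - l y - q y) + (w y - w x) * q y + l y * (w y - w x - k y))
      \<in> o[nhds x](\<lambda>y. (norm (y - x))\<^sup>2)"
    using 1 2 3 by (intro sum_in_smallo) (simp_all add: power2_eq_square)
  moreover have "w y * (u y - u x - l y - q y) + (w y - w x) * q y + l y * (w y - w x - k y) =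
      w y * (u y - u x) - (w x *\<^sub>R gradient u x) \<bullet> (y - x) -
      (y - x) \<bullet> (((w x / 2) *\<^sub>R hessian u x + outer_product (gradient u x) (gradient w x)) *v (y - x))" for y
  proof -
    have "(y - x) \<bullet> (((w x / 2) *\<^sub>R hessian u x + outer_product (gradient u x) (gradient w x)) *v (y - x)) =
        w x * q y + l y * k y"
      by (simp add: q_def l_def k_def matrix_vector_mult_add_rdistrib inner_add_right inner_outer_product
          scaleR_matrix_vector_assoc[symmetric])
    moreover have "(w x *\<^sub>R gradient u x) \<bullet> (y - x) = w x * l y"
      by (simp add: l_def)
    ultimately show ?thesis
      by (simp add: algebra_simps)
  qed
  ultimately show ?thesis by simp
qed

section \<open>The weighted measure\<close>

lemma sets_weighted_measure: "sets (weighted_measure \<Omega> w) = sets (lebesgue_on \<Omega>)"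
  by (simp add: weighted_measure_def)

lemma sets_weighted_measure_iff:
  assumes "open \<Omega>"
  shows "B \<in> sets (weighted_measure \<Omega> w) \<longleftrightarrow> B \<in> sets lebesgue \<and> B \<subseteq> \<Omega>"
  using assms by (auto simp: sets_weighted_measure sets_restrict_space_iff)

lemma
  fixes f :: "real^'n \<Rightarrow> real"
  assumes \<Omega>: "open \<Omega>" "continuous_on \<Omega> w" "\<forall>y\<in>\<Omega>. 0 \<le> w y"
    and B: "B \<in> sets lebesgue" "B \<subseteq> \<Omega>" and f: "set_borel_measurable lebesgue B f"
  shows set_integrable_weighted_measure:
      "set_integrable (weighted_measure \<Omega> w) B f \<longleftrightarrow> set_integrable lebesgue B (\<lambda>y. w y * f y)"
    and set_integral_weighted_measure:
      "(LINT y:B|weighted_measure \<Omega> w. f y) = (LINT y:B|lebesgue. w y * f y)"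
proof -
  have sets: "\<Omega> \<inter> space lebesgue \<in> sets lebesgue"
    using \<Omega>(1) by simp
  have w: "w \<in> borel_measurable (lebesgue_on \<Omega>)"
    using \<Omega> by (intro continuous_imp_measurable_on_sets_lebesgue) auto
  have f': "(\<lambda>y. indicator B y *\<^sub>R f y) \<in> borel_measurable (lebesgue_on \<Omega>)"
    using f unfolding set_borel_measurable_def by (rule measurable_restrict_space1)
  have nn: "AE y in lebesgue_on \<Omega>. 0 \<le> w y"
    using \<Omega>(3) by (intro AE_I2) simp
  have eq: "(\<lambda>y. indicator \<Omega> y *\<^sub>R w y *\<^sub>R indicator B y *\<^sub>R f y) =
      (\<lambda>y. indicator B y *\<^sub>R (w y * f y))"
    using B(2) by (intro ext) (auto split: split_indicator)
  show "set_integrable (weighted_measure \<Omega> w) B f \<longleftrightarrow> set_integrable lebesgue B (\<lambda>y. w y * f y)"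
    unfolding set_integrable_def weighted_measure_def
    by (simp only: integrable_density[OF f' w nn] integrable_restrict_space[OF sets] eq)
  show "(LINT y:B|weighted_measure \<Omega> w. f y) = (LINT y:B|lebesgue. w y * f y)"
    unfolding set_lebesgue_integral_def weighted_measure_def
    by (simp only: integral_density[OF f' w nn] integral_restrict_space[OF sets] eq)
qed

lemma measure_weighted_measure:
  fixes w :: "real^'n \<Rightarrow> real"
  assumes \<Omega>: "open \<Omega>" "continuous_on \<Omega> w" "\<forall>y\<in>\<Omega>. 0 \<le> w y"
    and B: "B \<in> sets lebesgue" "B \<subseteq> \<Omega>"
  shows "measure (weighted_measure \<Omega> w) B = (LINT y:B|lebesgue. w y)"
proof -
  have "B \<inter> space (weighted_measure \<Omega> w) = B"
    using B by (auto simp: weighted_measure_def)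
  then have "measure (weighted_measure \<Omega> w) B = (LINT y:B|weighted_measure \<Omega> w. 1)"
    unfolding set_lebesgue_integral_def by simp
  also have "\<dots> = (LINT y:B|lebesgue. w y)"
    using B by (subst set_integral_weighted_measure[OF \<Omega>]) (auto simp: set_borel_measurable_def)
  finally show ?thesis .
qed

text \<open>A measure with a density vanishes on null sets. The metric measure structure gives
  positivity for the weighted measure only; Lebesgue averages need this transfer.\<close>

lemma emeasure_weighted_measure_pos:
  assumes "open \<Omega>" "continuous_on \<Omega> w" "B \<in> sets lebesgue" "B \<subseteq> \<Omega>"
    and pos: "0 < emeasure (weighted_measure \<Omega> w) B"
  shows "0 < emeasure lebesgue B"
proof (rule ccontr)
  assume "\<not> 0 < emeasure lebesgue B"
  then have "emeasure (lebesgue_on \<Omega>) B = 0"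
    using assms by (subst emeasure_restrict_space) (auto simp: not_gr_zero)
  then have null: "B \<in> null_sets (lebesgue_on \<Omega>)"
    using assms by (intro null_setsI) (auto simp: sets_restrict_space_iff)
  have "w \<in> borel_measurable (lebesgue_on \<Omega>)"
    using assms by (intro continuous_imp_measurable_on_sets_lebesgue) auto
  then have "(\<lambda>y. ennreal (w y)) \<in> borel_measurable (lebesgue_on \<Omega>)"
    by measurable
  then have "B \<in> null_sets (weighted_measure \<Omega> w)"
    unfolding weighted_measure_def using null
    by (subst null_sets_density_iff) (auto intro: AE_mp[OF AE_not_in[OF null]] simp: null_setsD2)
  with pos show False by auto
qed

text \<open>For the metric \<open>d\<close> the measure of balls of fixed radius is lower semicontinuous in the centre, so
  its superlevel sets are \<open>d\<close>-open.\<close>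

lemma borel_measurable_measure_ball:
  assumes "metric_measure_space X d \<mu>"
  shows "(\<lambda>y. measure \<mu> (dball X d y r)) \<in> borel_measurable \<mu>"
proof -
  interpret Metric_space X d
    using assms by (simp add: metric_measure_space_def)
  have [simp]: "space \<mu> = X"
    and sets: "\<And>U. openin mtopology U \<Longrightarrow> U \<in> sets \<mu>"
    and fin: "\<And>y r. y \<in> X \<Longrightarrow> r > 0 \<Longrightarrow> emeasure \<mu> (mball y r) < \<infinity>"
    using assms by (auto simp: metric_measure_space_def)
  have ball: "mball y s \<in> fmeasurable \<mu>" for y s
  proof (cases "y \<in> X \<and> s > 0")
    case True
    then show ?thesis
      using fin[of y s] sets[OF openin_mball] by (auto simp: fmeasurable_def)
  next
    case False
    then have "mball y s = {}"
      using mball_eq_empty by auto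
    then show ?thesis by simp
  qed
  have "openin mtopology {y \<in> X. a < measure \<mu> (mball y r)}" for a
    unfolding openin_mtopology
  proof (intro conjI allI impI)
    fix y
    assume "y \<in> {y \<in> X. a < measure \<mu> (mball y r)}"
    then have y: "y \<in> X" "a < measure \<mu> (mball y r)"
      by auto
    \<comment> \<open>These balls exhaust the open ball, so one of them already has measure above
      \<open>a\<close>; moving the centre by less than \<open>1 / Suc n\<close> keeps it inside the
      moved ball of radius \<open>r\<close>.\<close>
    define D where "D n = mball y (r - 1 / real (Suc n))" for n
    have UN: "(\<Union>n. D n) = mball y r"
    proof (intro equalityI subsetI)
      fix z assume z: "z \<in> mball y r"
      then have "0 < r - d y z"
        by simp
      then obtain n where "1 / real (Suc n) < r - d y z"
        by (metis nat_approx_posE of_nat_Suc)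
      then have "z \<in> D n"
        using z by (auto simp: D_def)
      then show "z \<in> (\<Union>n. D n)" by blast
    qed (auto simp: D_def intro: less_le_trans)
    have "incseq D"
      unfolding incseq_Suc_iff D_def
      by (intro allI mball_subset_concentric) (simp add: frac_le)
    then have "(\<lambda>n. measure \<mu> (D n)) \<longlonglongrightarrow> measure \<mu> (\<Union>n. D n)"
    proof (intro Lim_measure_incseq)
      show "range D \<subseteq> sets \<mu>"
        using ball by (auto simp: D_def fmeasurable_def)
      show "emeasure \<mu> (\<Union>n. D n) \<noteq> \<infinity>"
        using ball[of y r] unfolding UN by (auto simp: fmeasurable_def)
    qed
    from order_tendstoD(1)[OF this[unfolded UN] y(2)] obtain n where n: "a < measure \<mu> (D n)"
      by (auto simp: eventually_sequentially)
    have "mball y (1 / real (Suc n)) \<subseteq> {y \<in> X. a < measure \<mu> (mball y r)}"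
    proof
      fix z assume z: "z \<in> mball y (1 / real (Suc n))"
      have "D n \<subseteq> mball z r"
      proof
        fix p assume p: "p \<in> D n"
        then have "d z p \<le> d z y + d y p" "d z y < 1 / real (Suc n)" "d y p < r - 1 / real (Suc n)"
          using z triangle[of z y p] commute[of z y] by (auto simp: D_def)
        then show "p \<in> mball z r"
          using p z by (auto simp: D_def)
      qed
      then have "measure \<mu> (D n) \<le> measure \<mu> (mball z r)"
        using ball by (intro measure_mono_fmeasurable) (auto simp: D_def fmeasurable_def)
      then show "z \<in> {y \<in> X. a < measure \<mu> (mball y r)}"
        using n z by auto
    qed
    then show "\<exists>s>0. mball y s \<subseteq> {y \<in> X. a < measure \<mu> (mball y r)}"
      by (intro exI[of _ "1 / real (Suc n)"]) simp
  qed auto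
  from sets[OF this] show ?thesis
    by (subst borel_measurable_iff_greater) simp
qed

text \<open>The ball of radius \<open>R0\<close> about \<open>x\<close> contains every ball used, so
  symmetry, measurability, positive volume and the Euclidean bound hold with the same constants for
  all centres \<open>y\<close> near \<open>x\<close>.\<close>

lemma comparable_balls:
  fixes \<Omega> :: "(real^'n) set"
  assumes metric: "Metric_space UNIV d" and d_open: "dopen UNIV d \<Omega>"
    and "open \<Omega>" and symmetric: "symmetric_balls \<Omega> d" and "continuous_on \<Omega> w"
    and mms: "metric_measure_space \<Omega> d (weighted_measure \<Omega> w)" and x: "x \<in> \<Omega>"
    and finite_volume: "\<forall>\<^sub>F r in at_right 0. dball UNIV d x r \<in> lmeasurable"
  obtains R C where "0 < R" "0 < C"
    "\<And>y r. \<lbrakk>d x y < R; 0 < r; r \<le> R\<rbrakk> \<Longrightarrow> dball UNIV d y r \<subseteq> \<Omega> \<and>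
      symmetric_body (dball UNIV d y r) y \<and> dball UNIV d y r \<subseteq> cball y (C * r)"
proof -
  interpret E: Metric_space UNIV d
    by (rule metric)
  interpret S: Metric_space \<Omega> d
    using mms by (simp add: metric_measure_space_def)
  obtain R1 where R1: "R1 > 0" "E.mball x R1 \<subseteq> \<Omega>"
    using d_open x unfolding E.openin_mtopology by blast
  obtain R2 where R2: "R2 > 0" "\<And>r. 0 < r \<Longrightarrow> r < R2 \<Longrightarrow> E.mball x r \<in> lmeasurable"
    using finite_volume unfolding eventually_at_right_field by auto
  \<comment> \<open>\<open>R2\<close> is halved since finite volume is known only for radii strictly
    below it; \<open>R1\<close> keeps the ball in \<open>\<Omega>\<close>.\<close>
  define R0 where "R0 = min R1 (R2 / 2)"
  have R0: "0 < R0" "E.mball x R0 \<subseteq> \<Omega>" "E.mball x R0 \<in> lmeasurable"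
    using R1 R2 by (auto simp: R0_def)
  have sub: "E.mball y r \<subseteq> E.mball x R0" if "d x y + r \<le> R0" for y r
  proof
    fix z assume "z \<in> E.mball y r"
    then show "z \<in> E.mball x R0"
      using E.triangle[of x y z] that by simp
  qed
  \<comment> \<open>Symmetry and volume refer to balls of the whole space, the metric measure
    structure to balls of \<open>\<Omega>\<close>; they agree once the former lie in
    \<open>\<Omega>\<close>.\<close>
  have ball_eq: "E.mball y r = S.mball y r" if "d x y + r \<le> R0" "0 < r" for y r
  proof -
    have sub\<Omega>: "E.mball y r \<subseteq> \<Omega>"
      using sub[OF that(1)] R0(2) by blast
    have "y \<in> \<Omega>"
      by (rule subsetD[OF sub\<Omega>]) (use that(2) in simp)
    with sub\<Omega> show ?thesis
      by (auto simp: E.mball_def S.mball_def)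
  qed
  have sets: "E.mball y r \<in> sets lebesgue" and pos: "0 < emeasure lebesgue (E.mball y r)"
    if "d x y + r \<le> R0" "0 < r" for y r
  proof -
    have "y \<in> E.mball y r"
      using that(2) by simp
    then have y: "y \<in> \<Omega>"
      using sub[OF that(1)] R0(2) by blast
    have "S.mball y r \<in> sets (weighted_measure \<Omega> w)"
      using mms S.openin_mball by (simp add: metric_measure_space_def)
    then have *: "E.mball y r \<in> sets lebesgue" "E.mball y r \<subseteq> \<Omega>"
      using sets_weighted_measure_iff[OF \<open>open \<Omega>\<close>] ball_eq[OF that] by auto
    moreover have "0 < emeasure (weighted_measure \<Omega> w) (E.mball y r)"
      using mms y that(2) unfolding ball_eq[OF that] by (simp add: metric_measure_space_def)
    ultimately show "0 < emeasure lebesgue (E.mball y r)"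
      using emeasure_weighted_measure_pos assms(3,5) by blast
    show "E.mball y r \<in> sets lebesgue" by (rule *)
  qed
  have sym: "y + v \<in> E.mball y r \<longleftrightarrow> y - v \<in> E.mball y r" if "d x y + r \<le> R0" "0 < r" for y v r
    using symmetric sub[OF that(1)] R0(2) that(2) unfolding symmetric_balls_def
    by (metis E.centre_in_mball_iff UNIV_I subset_iff)
  interpret symmetric_metric d x R0
  proof
    fix y v r
    assume "d x y + r \<le> R0" "d y (y + v) < r"
    then show "d y (y - v) < r"
      using sym[of y r v] E.nonneg[of y "y + v"] by simp
  qed
  obtain \<rho> where \<rho>: "0 < \<rho>" "\<And>z. d x z < R0 / 4 \<Longrightarrow> norm (z - x) \<le> \<rho>"
    using ball_bounded[OF R0(1,3) sets pos] R0(1) by auto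
  \<comment> \<open>The constant of \<open>norm_le_dist\<close> for \<open>r0 = R0 / 4\<close>, the
    radius on which \<open>ball_bounded\<close> provides \<open>\<rho>\<close>; the conditions
    \<open>r0 / 2\<close> and \<open>r0 / 4\<close> become \<open>R0 / 8\<close> and
    \<open>R0 / 16\<close>.\<close>
  let ?K = "8 * \<rho> / (R0 / 4)"
  have le: "norm (z - y) \<le> ?K * d y z" if "d x y < R0 / 8" "d y z < R0 / 16" for y z
    by (rule norm_le_dist) (use \<rho>(2) that R0(1) in auto)
  show ?thesis
  proof (rule that[of "R0 / 16" ?K])
    fix y r
    assume y: "d x y < R0 / 16" and r: "0 < r" "r \<le> R0 / 16"
    then have yr: "d x y + r \<le> R0"
      using E.nonneg[of x y] by linarith
    have "E.mball y r \<subseteq> \<Omega>"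
      using sub[OF yr] R0(2) by blast
    moreover have "E.mball y r \<in> lmeasurable"
      by (rule fmeasurableI2[OF R0(3) sub[OF yr] sets[OF yr r(1)]])
    moreover from this have "0 < measure lebesgue (E.mball y r)"
      using pos[OF yr r(1)] by (simp add: emeasure_eq_measure2)
    moreover have "E.mball y r \<subseteq> cball y (?K * r)"
    proof
      fix z assume "z \<in> E.mball y r"
      then have z: "d y z < r"
        by simp
      then have "norm (z - y) \<le> ?K * d y z"
        using y r R0(1) by (intro le) auto
      also have "\<dots> \<le> ?K * r"
        using z \<rho>(1) R0(1) by (intro mult_left_mono) auto
      finally show "z \<in> cball y (?K * r)"
        by (simp add: dist_norm norm_minus_commute)
    qed
    ultimately show "E.mball y r \<subseteq> \<Omega> \<and> symmetric_body (E.mball y r) y \<and> E.mball y r \<subseteq> cball y (?K * r)"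
      unfolding symmetric_body_def using sym[OF yr r(1)] by blast
  qed (use R0 \<rho> in auto)
qed

lemma set_borel_measurable_weighted_measure:
  assumes "set_borel_measurable lebesgue B f"
  shows "set_borel_measurable (weighted_measure \<Omega> w) B f"
  using measurable_restrict_space1[OF assms[unfolded set_borel_measurable_def], of \<Omega>]
  by (simp add: set_borel_measurable_def weighted_measure_def)

text \<open>The sets lie in Euclidean balls shrinking to \<open>x\<close>, where \<open>f\<close> is
  nearly constant. The measure is general because both Lebesgue measure and the weighted measure are
  needed.\<close>

lemma
  fixes f :: "'a::real_normed_vector \<Rightarrow> real"
  assumes B: "\<forall>\<^sub>F r in at_right 0. B r \<in> fmeasurable \<nu> \<and> 0 < measure \<nu> (B r) \<and>
      set_borel_measurable \<nu> (B r) f \<and> B r \<subseteq> cball x (C * r)"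
    and f: "isCont f x"
  shows set_integrable_near: "\<forall>\<^sub>F r in at_right (0::real). set_integrable \<nu> (B r) f"
    and tendsto_avg: "((\<lambda>r. avg \<nu> (B r) f) \<longlongrightarrow> f x) (at_right 0)"
proof -
  have main: "\<forall>\<^sub>F r in at_right 0. set_integrable \<nu> (B r) f \<and> \<bar>avg \<nu> (B r) f - f x\<bar> \<le> \<epsilon>" if "0 < \<epsilon>" for \<epsilon>
  proof -
    have "(f \<longlongrightarrow> f x) (nhds x)"
      using f by (simp add: isCont_def tendsto_at_iff_tendsto_nhds)
    then have "\<forall>\<^sub>F y in nhds x. dist (f y) (f x) < \<epsilon>"
      using that by (rule tendstoD)
    then have "\<forall>\<^sub>F r in at_right 0. \<forall>y\<in>cball x (C * r). dist (f y) (f x) < \<epsilon>"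
      by (rule eventually_cball_subset)
    with B show ?thesis
    proof eventually_elim
      case (elim r)
      then have near: "\<bar>f y - f x\<bar> \<le> \<epsilon>" if "y \<in> B r" for y
        using that by (force simp: dist_real_def)
      have int: "set_integrable \<nu> (B r) f"
        by (rule set_integrable_bounded[where c = "\<bar>f x\<bar> + \<epsilon>"]) (use elim near in \<open>force+\<close>)
      have c: "set_integrable \<nu> (B r) (\<lambda>_. - f x)"
        using elim by (intro set_integrable_const) blast
      have "avg \<nu> (B r) (\<lambda>y. f y + - f x) = avg \<nu> (B r) f - f x"
        using elim avg_add[OF int c] avg_const[of "B r" \<nu> "- f x"] by simp
      moreover have "\<bar>avg \<nu> (B r) (\<lambda>y. f y + - f x)\<bar> \<le> \<epsilon>"
        by (rule abs_avg_le_const) (use elim near set_integral_add(1)[OF int c] in auto)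
      ultimately show ?case
        using int by simp
    qed
  qed
  show "\<forall>\<^sub>F r in at_right 0. set_integrable \<nu> (B r) f"
    using main[OF zero_less_one] by eventually_elim blast
  have "((\<lambda>r. avg \<nu> (B r) f - f x) \<longlongrightarrow> 0) (at_right 0)"
    by (rule tendsto_zero_abs_leI, rule eventually_mono[OF main]) auto
  then show "((\<lambda>r. avg \<nu> (B r) f) \<longlongrightarrow> f x) (at_right 0)"
    by (rule LIM_zero_cancel)
qed

text \<open>Algebraic core of the symmetrized estimate: \<open>b\<close> and \<open>\<beta>\<close>
  stand for the volumes of the balls around \<open>x\<close> and \<open>y\<close>, \<open>m\<close>
  for the weighted measure of the latter, \<open>v\<close> for \<open>u y - u x\<close>, and
  \<open>a\<close> for a lower bound of the weight. The errors from comparing volumes and from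
  comparing \<open>m\<close> with \<open>w * \<beta>\<close> stay separate.\<close>

lemma weighted_ratio_bound:
  fixes a :: real
  assumes "0 < a" "a \<le> w" "0 < \<beta>" "0 < r" "r \<le> 1" "0 \<le> \<eta>" "\<eta> \<le> 1"
    and m: "\<bar>m - w * \<beta>\<bar> \<le> a / 2 * \<eta> * r * \<beta>" and v: "\<bar>v\<bar> \<le> K * r"
  shows "\<bar>b * (w * v / m) - v\<bar> \<le> K * r * (2 * \<bar>1 - b / \<beta>\<bar> + \<eta> * r)"
proof -
  have "\<eta> * r \<le> 1"
    using assms by (simp add: mult_le_one)
  then have "a / 2 * (\<eta> * r) * \<beta> \<le> a / 2 * 1 * \<beta>"
    using assms by (intro mult_right_mono mult_left_mono) auto
  then have "a / 2 * \<eta> * r * \<beta> \<le> a / 2 * \<beta>"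
    by (simp add: mult_ac)
  moreover have "a * \<beta> \<le> w * \<beta>"
    using assms by (intro mult_right_mono) auto
  moreover have "w * \<beta> - m \<le> a / 2 * \<eta> * r * \<beta>"
    using m by linarith
  ultimately have m': "a / 2 * \<beta> \<le> m"
    by linarith
  have m0: "0 < m"
    using assms by (intro less_le_trans[OF _ m']) simp
  \<comment> \<open>\<open>\<theta>\<close> isolates the weight error: the bound
    \<open>a / 2 * \<beta> \<le> m\<close> cancels the factor \<open>a / 2\<close> of the hypothesis
    and leaves \<open>\<eta> * r\<close>.\<close>
  define \<theta> where "\<theta> = w * \<beta> / m"
  have "\<bar>\<theta> - 1\<bar> = \<bar>m - w * \<beta>\<bar> / m"
    using m0 by (simp add: \<theta>_def field_simps abs_minus_commute)
  also have "\<dots> \<le> (\<eta> * r * (a / 2 * \<beta>)) / m"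
    using m m0 by (intro divide_right_mono) (simp_all add: mult_ac)
  also have "\<dots> \<le> (\<eta> * r * m) / m"
    using m' m0 assms by (intro divide_right_mono mult_left_mono) auto
  finally have \<theta>: "\<bar>\<theta> - 1\<bar> \<le> \<eta> * r"
    using m0 by simp
  then have \<theta>2: "\<bar>\<theta>\<bar> \<le> 2"
    using \<open>\<eta> * r \<le> 1\<close> by linarith
  have "b * (w * v / m) - v = v * ((b / \<beta> - 1) * \<theta> + (\<theta> - 1))"
    using assms m0 by (simp add: \<theta>_def field_simps)
  also have "\<bar>\<dots>\<bar> \<le> \<bar>v\<bar> * (\<bar>b / \<beta> - 1\<bar> * \<bar>\<theta>\<bar> + \<bar>\<theta> - 1\<bar>)"
    unfolding abs_mult by (intro mult_left_mono order_trans[OF abs_triangle_ineq]) (auto simp: abs_mult)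
  also have "\<dots> \<le> (K * r) * (\<bar>b / \<beta> - 1\<bar> * 2 + \<eta> * r)"
    using v \<theta> \<theta>2 by (intro mult_mono add_mono mult_left_mono) (auto intro: order_trans[OF abs_ge_zero])
  finally show ?thesis
    by (simp add: abs_minus_commute mult_ac)
qed

section \<open>The asymptotic mean value Laplacians\<close>

text \<open>\<open>balls\<close> is the conclusion of \<open>comparable_balls\<close>; with it as an
  assumption the remaining estimates work with \<open>R\<close> and \<open>C\<close> and need no
  further iteration of reflections.\<close>

locale weighted_balls = Metric_space UNIV d
  for d :: "real^'n \<Rightarrow> real^'n \<Rightarrow> real" +
  fixes \<Omega> :: "(real^'n) set" and w :: "real^'n \<Rightarrow> real" and x :: "real^'n" and M :: "real^'n^'n"
    and R C :: real
  assumes open_\<Omega>: "open \<Omega>"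
    and w_C1: "C1_on \<Omega> w"
    and w_nonneg: "\<forall>y\<in>\<Omega>. 0 \<le> w y"
    and mms: "metric_measure_space \<Omega> d (weighted_measure \<Omega> w)"
    and x: "x \<in> \<Omega>" and wx: "w x > 0"
    and M: "((\<lambda>r. moment_matrix d r x) \<longlongrightarrow> M) (at_right 0)"
    and R: "0 < R" and C: "0 < C"
    and balls: "\<And>y r. \<lbrakk>d x y < R; 0 < r; r \<le> R\<rbrakk> \<Longrightarrow> mball y r \<subseteq> \<Omega> \<and>
      symmetric_body (mball y r) y \<and> mball y r \<subseteq> cball y (C * r)"
begin

abbreviation "\<mu> \<equiv> weighted_measure \<Omega> w"

lemma ball_lmeasurable: "\<lbrakk>d x y < R; 0 < r; r \<le> R\<rbrakk> \<Longrightarrow> mball y r \<in> lmeasurable"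
  and ball_measure_pos: "\<lbrakk>d x y < R; 0 < r; r \<le> R\<rbrakk> \<Longrightarrow> 0 < measure lebesgue (mball y r)"
  and ball_subset: "\<lbrakk>d x y < R; 0 < r; r \<le> R\<rbrakk> \<Longrightarrow> mball y r \<subseteq> \<Omega>"
  and ball_subset_cball: "\<lbrakk>d x y < R; 0 < r; r \<le> R\<rbrakk> \<Longrightarrow> mball y r \<subseteq> cball y (C * r)"
  using balls unfolding symmetric_body_def by blast+

lemma ball_eq:
  assumes "d x y < R" "0 < r" "r \<le> R"
  shows "dball \<Omega> d y r = mball y r"
proof -
  interpret S: Metric_space \<Omega> d
    using mms by (simp add: metric_measure_space_def)
  have "y \<in> \<Omega>"
    by (rule subsetD[OF ball_subset[OF assms]]) (use assms in simp)
  then show ?thesis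
    using ball_subset[OF assms] by (auto simp: mball_def S.mball_def)
qed

lemma eventually_small: "\<forall>\<^sub>F r in at_right 0. 0 < r \<and> r < R"
  using R eventually_at_right_real by (auto simp: eventually_at_right_field)

lemma w_differentiable: "y \<in> \<Omega> \<Longrightarrow> w differentiable (at y)"
  using w_C1 by (simp add: C1_on_def)

lemma continuous_on_differentiable:
  assumes "\<And>y. y \<in> \<Omega> \<Longrightarrow> f differentiable (at y)"
  shows "continuous_on \<Omega> f"
  using assms by (intro continuous_at_imp_continuous_on ballI differentiable_imp_continuous_within)

lemma w_continuous: "continuous_on \<Omega> w"
  by (intro continuous_on_differentiable w_differentiable)

lemma set_borel_measurable_ball:
  fixes f :: "real^'n \<Rightarrow> real"
  assumes "continuous_on \<Omega> f" "d x y < R" "0 < r" "r \<le> R"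
  shows "set_borel_measurable lebesgue (mball y r) f"
  using set_borel_measurable_continuous[OF open_\<Omega> assms(1)] ball_lmeasurable[OF assms(2-)]
    ball_subset[OF assms(2-)] by (simp add: fmeasurableD)

lemma bodies: "\<forall>\<^sub>F r in at_right 0. symmetric_body (mball x r) x \<and> mball x r \<subseteq> cball x (C * r)"
  using eventually_small by eventually_elim (use balls[of x] in auto)

lemma lebesgue_balls:
  fixes f :: "real^'n \<Rightarrow> real"
  assumes "continuous_on \<Omega> f"
  shows "\<forall>\<^sub>F r in at_right 0. mball x r \<in> lmeasurable \<and> 0 < measure lebesgue (mball x r) \<and>
    set_borel_measurable lebesgue (mball x r) f \<and> mball x r \<subseteq> cball x (C * r)"
  using eventually_small
  by eventually_elim (use set_borel_measurable_ball[OF assms, of x] ball_lmeasurable[of x]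
    ball_measure_pos[of x] ball_subset_cball[of x] in auto)

lemma weighted_balls:
  fixes f :: "real^'n \<Rightarrow> real"
  assumes "continuous_on \<Omega> f"
  shows "\<forall>\<^sub>F r in at_right 0. mball x r \<in> fmeasurable \<mu> \<and> 0 < measure \<mu> (mball x r) \<and>
    set_borel_measurable \<mu> (mball x r) f \<and> mball x r \<subseteq> cball x (C * r)"
  using eventually_small
proof eventually_elim
  case (elim r)
  have "dball \<Omega> d x r \<in> sets \<mu>" "0 < emeasure \<mu> (dball \<Omega> d x r)" "emeasure \<mu> (dball \<Omega> d x r) < \<infinity>"
    using mms x elim Metric_space.openin_mball[of \<Omega> d x r] by (auto simp: metric_measure_space_def)
  then have "mball x r \<in> fmeasurable \<mu>" "0 < measure \<mu> (mball x r)"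
    using ball_eq[of x r] elim R by (auto simp: fmeasurable_def measure_def enn2real_positive_iff)
  then show ?case
    using set_borel_measurable_weighted_measure[OF set_borel_measurable_ball[OF assms, of x r]]
      ball_subset_cball[of x r] elim by auto
qed

lemma measure_ball:
  assumes "d x y < R" "0 < r" "r \<le> R"
  shows "measure \<mu> (mball y r) = (LINT z:mball y r|lebesgue. w z)"
  using assms ball_lmeasurable ball_subset
  by (intro measure_weighted_measure open_\<Omega> w_continuous w_nonneg) auto

lemma set_integral_ball:
  assumes "set_borel_measurable lebesgue (mball x r) f" "0 < r" "r \<le> R"
  shows "set_integrable \<mu> (mball x r) f \<longleftrightarrow> set_integrable lebesgue (mball x r) (\<lambda>y. w y * f y)"
    and "(LINT y:mball x r|\<mu>. f y) = (LINT y:mball x r|lebesgue. w y * f y)"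
  using assms ball_lmeasurable[of x r] ball_subset[of x r] R
    set_integrable_weighted_measure[OF open_\<Omega> w_continuous w_nonneg]
    set_integral_weighted_measure[OF open_\<Omega> w_continuous w_nonneg] by (simp_all add: fmeasurableD)

lemma isCont_continuous_on: "continuous_on \<Omega> f \<Longrightarrow> isCont f x"
  using open_\<Omega> x by (simp add: continuous_on_eq_continuous_at)

section \<open>Lebesgue values and the AMV limit\<close>

lemma avg_w: "((\<lambda>r. avg lebesgue (mball x r) w) \<longlongrightarrow> w x) (at_right 0)"
  using lebesgue_balls[OF w_continuous] isCont_continuous_on[OF w_continuous] by (rule tendsto_avg)

lemma C2_onD:
  assumes "C2_on \<Omega> u"
  shows "\<And>y. y \<in> \<Omega> \<Longrightarrow> u differentiable (at y)" "gradient u differentiable (at x)" "continuous_on \<Omega> u"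
  using assms x continuous_on_differentiable by (auto simp: C2_on_def C1_on_def)

text \<open>By continuity the averages of \<open>\<bar>u y - c\<bar>\<close> tend to
  \<open>\<bar>u x - c\<bar>\<close>, which vanishes only for \<open>c = u x\<close>. This also
  gives the uniqueness behind the definite description in \<open>lebesgue_value\<close>.\<close>

lemma has_lebesgue_value_iff:
  assumes u: "continuous_on \<Omega> u"
  shows "has_lebesgue_value \<Omega> d \<mu> u x c \<longleftrightarrow> c = u x"
proof -
  have eq: "\<forall>\<^sub>F r in at_right 0. mball x r = dball \<Omega> d x r"
    using eventually_small by eventually_elim (use ball_eq[of x] in auto)
  have cont: "continuous_on \<Omega> (\<lambda>y. \<bar>u y - c\<bar>)"
    by (intro continuous_intros u)
  have "((\<lambda>r. avg \<mu> (mball x r) (\<lambda>y. \<bar>u y - c\<bar>)) \<longlongrightarrow> \<bar>u x - c\<bar>) (at_right 0)"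
    using weighted_balls[OF cont] isCont_continuous_on[OF cont] by (rule tendsto_avg)
  then have lim: "((\<lambda>r. avg \<mu> (dball \<Omega> d x r) (\<lambda>y. \<bar>u y - c\<bar>)) \<longlongrightarrow> \<bar>u x - c\<bar>) (at_right 0)"
    by (rule Lim_transform_eventually) (use eq in eventually_elim, auto)
  have "\<forall>\<^sub>F r in at_right 0. set_integrable \<mu> (mball x r) u"
    using weighted_balls[OF u] isCont_continuous_on[OF u] by (rule set_integrable_near)
  with eq have "\<forall>\<^sub>F r in at_right 0. set_integrable \<mu> (dball \<Omega> d x r) u"
    by eventually_elim simp
  then show ?thesis
    unfolding has_lebesgue_value_def using lim tendsto_unique[OF trivial_limit_at_right_real lim]
    by fastforce
qed

lemma
  assumes "C2_on \<Omega> u"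
  shows lebesgue_point_C2: "lebesgue_point \<Omega> d \<mu> u x"
    and lebesgue_value_C2: "lebesgue_value \<Omega> d \<mu> u x = u x"
  using has_lebesgue_value_iff[OF C2_onD(3)[OF assms]]
  by (auto simp: lebesgue_point_def lebesgue_value_def)

text \<open>A weighted average is the quotient of the Lebesgue averages of
  \<open>w * (u - u x)\<close> and of \<open>w\<close>. The numerator over \<open>r^2\<close> is a
  second-order limit; the denominator tends to \<open>w x\<close>.\<close>

lemma amv_limit:
  assumes u: "C2_on \<Omega> u"
  shows "((\<lambda>r. amv_quot \<Omega> d \<mu> r u x) \<longlongrightarrow>
    1 / 2 * trace (M ** hessian u x) + 1 / w x * (gradient w x \<bullet> (M *v gradient u x))) (at_right 0)"
proof -
  let ?Q = "(w x / 2) *\<^sub>R hessian u x + outer_product (gradient u x) (gradient w x)"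
  let ?f = "\<lambda>y. w y * (u y - u x)"
  have cont: "continuous_on \<Omega> ?f"
    by (intro continuous_intros C2_onD(3)[OF u] w_continuous)
  have "((\<lambda>r. 1 / r\<^sup>2 * avg lebesgue (mball x r) ?f) \<longlongrightarrow> trace (M ** ?Q)) (at_right 0)"
  proof (rule avg_second_order_limit(2)[OF C bodies M])
    show "linear (\<lambda>v. (w x *\<^sub>R gradient u x) \<bullet> v)"
      by (intro bounded_linear.linear bounded_linear_inner_right)
    show "(\<lambda>y. ?f y - (w x *\<^sub>R gradient u x) \<bullet> (y - x) - (y - x) \<bullet> (?Q *v (y - x)))
        \<in> o[nhds x](\<lambda>y. (norm (y - x))\<^sup>2)"
      by (rule weighted_second_order_expansion[OF open_\<Omega> x C2_onD(1,2)[OF u] w_differentiable[OF x]])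
    show "\<forall>\<^sub>F r in at_right 0. set_borel_measurable lebesgue (mball x r) ?f"
      using lebesgue_balls[OF cont] by eventually_elim blast
  qed
  from tendsto_divide[OF this avg_w] wx
  have lim: "((\<lambda>r. 1 / r\<^sup>2 * avg lebesgue (mball x r) ?f / avg lebesgue (mball x r) w) \<longlongrightarrow>
      trace (M ** ?Q) / w x) (at_right 0)"
    by simp
  have "\<forall>\<^sub>F r in at_right 0. 1 / r\<^sup>2 * avg lebesgue (mball x r) ?f / avg lebesgue (mball x r) w =
      amv_quot \<Omega> d \<mu> r u x"
    using eventually_small
  proof eventually_elim
    case (elim r)
    then have r: "0 < r" "r \<le> R" and dx: "d x x < R"
      using R by auto
    have meas: "set_borel_measurable lebesgue (mball x r) (\<lambda>y. u y - u x)"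
      by (intro set_borel_measurable_ball continuous_intros C2_onD(3)[OF u] r dx)
    show ?case
      using ball_measure_pos[OF dx r]
      by (simp add: amv_quot_def avg_def lebesgue_value_C2[OF u] ball_eq[OF dx r]
          set_integral_ball(2)[OF meas r] measure_ball[OF dx r])
  qed
  moreover have "trace (M ** ?Q) / w x =
      1 / 2 * trace (M ** hessian u x) + 1 / w x * (gradient w x \<bullet> (M *v gradient u x))"
    using wx by (simp add: matrix_add_ldistrib trace_add matrix_mult_scaleR_right trace_scaleR
        trace_mult_outer_product field_simps)
  ultimately show ?thesis
    using lim by (simp add: tendsto_cong)
qed

text \<open>By symmetry about \<open>y\<close> the linear part of \<open>w\<close> averages out over the ball around \<open>y\<close>.\<close>

lemma measure_ball_approx:
  assumes "0 < \<epsilon>"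
  shows "\<forall>\<^sub>F r in at_right 0. \<forall>y\<in>mball x r.
    \<bar>measure \<mu> (dball \<Omega> d y r) - w y * measure lebesgue (mball y r)\<bar> \<le> \<epsilon> * r * measure lebesgue (mball y r)"
proof -
  \<comment> \<open>\<open>\<epsilon> / C\<close>, because points of the ball around
    \<open>y\<close> are within \<open>C * r\<close> of \<open>y\<close>.\<close>
  obtain \<delta> where \<delta>: "0 < \<delta>" "\<And>y z. \<lbrakk>dist y x < \<delta>; dist z x < \<delta>\<rbrakk> \<Longrightarrow>
      \<bar>w z - w y - gradient w y \<bullet> (z - y)\<bar> \<le> \<epsilon> / C * norm (z - y)"
    using first_order_expansion_uniform[OF open_\<Omega> x w_C1, of "\<epsilon> / C"] assms C by auto
  have "\<forall>\<^sub>F y in nhds x. dist y x < \<delta>"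
    using \<delta>(1) by (auto simp: eventually_nhds_metric)
  \<comment> \<open>The factor 2 accounts for two displacements of at most \<open>C * r\<close>,
    from \<open>x\<close> to \<open>y\<close> and from \<open>y\<close> to \<open>z\<close>.\<close>
  then have "\<forall>\<^sub>F r in at_right 0. \<forall>y\<in>cball x ((2 * C) * r). dist y x < \<delta>"
    by (rule eventually_cball_subset)
  with eventually_small show ?thesis
  proof eventually_elim
    case (elim r)
    show ?case
    proof
      fix y assume y: "y \<in> mball x r"
      with elim have y': "d x y < R" and r: "0 < r" "r \<le> R" and dx: "d x x < R"
        using R by auto
      let ?A = "mball y r"
      let ?e = "\<lambda>z. w z - w y - gradient w y \<bullet> (z - y)"
      have A: "?A \<in> lmeasurable" "0 < measure lebesgue ?A"
        using ball_lmeasurable[OF y' r] ball_measure_pos[OF y' r] .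
      have yx: "dist y x \<le> C * r"
        using y ball_subset_cball[OF dx r] by (auto simp: dist_commute)
      have e: "\<bar>?e z\<bar> \<le> \<epsilon> * r" if z: "z \<in> ?A" for z
      proof -
        have zy: "norm (z - y) \<le> C * r"
          using z ball_subset_cball[OF y' r] by (auto simp: dist_norm norm_minus_commute)
        then have "dist z x \<le> 2 * C * r"
          using yx dist_triangle[of z x y] by (simp add: dist_norm)
        moreover have "dist y x \<le> 2 * C * r"
          using yx r C by (auto intro: order_trans)
        ultimately have "\<bar>?e z\<bar> \<le> \<epsilon> / C * norm (z - y)"
          using elim by (intro \<delta>(2)) (auto simp: dist_commute)
        also have "\<dots> \<le> \<epsilon> / C * (C * r)"
          using zy assms C by (intro mult_left_mono) auto
        finally show ?thesis
          using C by simp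
      qed
      have "set_borel_measurable lebesgue ?A ?e"
        by (intro set_borel_measurable_ball continuous_intros w_continuous y' r)
      then have inte: "set_integrable lebesgue ?A ?e"
        using A e by (intro set_integrable_bounded)
      have intc: "set_integrable lebesgue ?A (\<lambda>z. w y)"
        using A by (intro set_integrable_const)
      have intl: "set_integrable lebesgue ?A (\<lambda>z. gradient w y \<bullet> (z - y))"
        using A ball_subset_cball[OF y' r] bounded_subset[OF bounded_cball]
        by (intro set_integrable_continuous_bounded continuous_intros) auto
      have "symmetric_body ?A y"
        using balls[OF y' r] by blast
      then have l0: "avg lebesgue ?A (\<lambda>z. gradient w y \<bullet> (z - y)) = 0"
        by (rule avg_odd) (intro bounded_linear.linear bounded_linear_inner_right)
      have "avg lebesgue ?A w = avg lebesgue ?A (\<lambda>z. ?e z + (w y + gradient w y \<bullet> (z - y)))"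
        by simp
      also have "\<dots> = avg lebesgue ?A ?e + w y"
        using avg_add[OF inte set_integral_add(1)[OF intc intl]] avg_add[OF intc intl] l0 avg_const[OF A]
        by simp
      finally have "\<bar>avg lebesgue ?A w - w y\<bar> \<le> \<epsilon> * r"
        using abs_avg_le_const[OF A inte e] by simp
      then have "\<bar>avg lebesgue ?A w - w y\<bar> * measure lebesgue ?A \<le> \<epsilon> * r * measure lebesgue ?A"
        by (intro mult_right_mono) auto
      moreover have "avg lebesgue ?A w * measure lebesgue ?A = measure \<mu> (dball \<Omega> d y r)"
        using A by (simp add: avg_def ball_eq[OF y' r] measure_ball[OF y' r])
      moreover have "\<bar>avg lebesgue ?A w - w y\<bar> * measure lebesgue ?A =
          \<bar>avg lebesgue ?A w * measure lebesgue ?A - w y * measure lebesgue ?A\<bar>"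
        using A by (simp add: left_diff_distrib[symmetric] abs_mult)
      ultimately show "\<bar>measure \<mu> (dball \<Omega> d y r) - w y * measure lebesgue ?A\<bar> \<le> \<epsilon> * r * measure lebesgue ?A"
        by simp
    qed
  qed
qed

text \<open>The summand of the SAMV integrand with the quotient of measures, multiplied by \<open>w\<close> and divided by
  \<open>\<mu>(B\<^sub>r(x))\<close>.\<close>

definition samv_term :: "(real^'n \<Rightarrow> real) \<Rightarrow> real \<Rightarrow> real^'n \<Rightarrow> real" where
  "samv_term u r y = w y * (u y - u x) / measure \<mu> (dball \<Omega> d y r)"

section \<open>Measurability and size of the symmetrized term\<close>

lemma set_borel_measurable_measure_ball:
  assumes "0 < r" "r \<le> R"
  shows "set_borel_measurable lebesgue (mball x r) (\<lambda>y. measure \<mu> (dball \<Omega> d y s))"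
proof -
  have dx: "d x x < R"
    using R by simp
  have "(\<lambda>y. measure \<mu> (dball \<Omega> d y s)) \<in> borel_measurable (lebesgue_on \<Omega>)"
    using borel_measurable_measure_ball[OF mms, of s]
    by (subst measurable_cong_sets[OF sets_weighted_measure[symmetric] refl])
  then have "set_borel_measurable lebesgue \<Omega> (\<lambda>y. measure \<mu> (dball \<Omega> d y s))"
    using open_\<Omega> by (auto simp: set_borel_measurable_def borel_measurable_restrict_space_iff)
  then show ?thesis
    by (rule set_borel_measurable_subset)
      (use ball_lmeasurable[OF dx assms] ball_subset[OF dx assms] in \<open>auto simp: fmeasurableD\<close>)
qed

lemma set_borel_measurable_samv_term:
  assumes "continuous_on \<Omega> u" "0 < r" "r \<le> R"
  shows "set_borel_measurable lebesgue (mball x r) (samv_term u r)"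
proof -
  have "set_borel_measurable lebesgue (mball x r) (\<lambda>y. w y * (u y - u x))"
    using R by (intro set_borel_measurable_ball continuous_intros assms w_continuous) auto
  \<comment> \<open>Both functions are cut off since measurability is known only on the ball;
    outside it the quotient is 0 / 0 = 0.\<close>
  then have "(\<lambda>y. (indicator (mball x r) y *\<^sub>R (w y * (u y - u x))) /
      (indicator (mball x r) y *\<^sub>R measure \<mu> (dball \<Omega> d y r))) \<in> borel_measurable lebesgue"
    using set_borel_measurable_measure_ball[OF assms(2,3), of r]
    unfolding set_borel_measurable_def by (rule borel_measurable_divide)
  moreover have "(\<lambda>y. (indicator (mball x r) y *\<^sub>R (w y * (u y - u x))) /
      (indicator (mball x r) y *\<^sub>R measure \<mu> (dball \<Omega> d y r))) =
      (\<lambda>y. indicator (mball x r) y *\<^sub>R samv_term u r y)"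
    by (auto simp: samv_term_def split: split_indicator)
  ultimately show ?thesis
    by (simp add: set_borel_measurable_def)
qed

text \<open>Multiplied by the volume of the ball around \<open>x\<close>, the term becomes
  \<open>u y - u x\<close> times nearly the ratio of the two volumes, because the weight almost
  cancels. The volume defect measures what remains.\<close>

lemma samv_term_bound:
  assumes u: "C2_on \<Omega> u" and \<eta>: "0 < \<eta>" "\<eta> \<le> 1"
  shows "\<forall>\<^sub>F r in at_right 0. \<forall>y\<in>mball x r.
    \<bar>measure lebesgue (mball x r) * samv_term u r y - (u y - u x)\<bar> \<le>
      (norm (gradient u x) + 1) * C * r * (2 * volume_defect d r x y + \<eta> * r)"
proof -
  \<comment> \<open>The added 1 absorbs the error of the first-order expansion of
    \<open>u\<close>.\<close>
  let ?k = "norm (gradient u x) + 1"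
  have "\<forall>\<^sub>F y in nhds x. \<bar>u y - u x - gradient u x \<bullet> (y - x)\<bar> \<le> 1 * norm (norm (y - x))"
    using landau_o.smallD[OF first_order_expansion[OF C2_onD(1)[OF u x]] zero_less_one]
    by (rule eventually_mono) (simp only: real_norm_def)
  then have du: "\<forall>\<^sub>F y in nhds x. \<bar>u y - u x\<bar> \<le> ?k * norm (y - x)"
  proof eventually_elim
    case (elim y)
    then show ?case
      using Cauchy_Schwarz_ineq2[of "gradient u x" "y - x"] by (simp add: distrib_right)
  qed
  have "(w \<longlongrightarrow> w x) (nhds x)"
    using isCont_continuous_on[OF w_continuous] by (simp add: isCont_def tendsto_at_iff_tendsto_nhds)
  then have "\<forall>\<^sub>F y in nhds x. w x / 2 < w y"
    using wx by (intro order_tendstoD) auto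
  with du have "\<forall>\<^sub>F y in nhds x. \<bar>u y - u x\<bar> \<le> ?k * norm (y - x) \<and> w x / 2 < w y"
    by eventually_elim blast
  then have near: "\<forall>\<^sub>F r in at_right 0. \<forall>y\<in>cball x (C * r).
      \<bar>u y - u x\<bar> \<le> ?k * norm (y - x) \<and> w x / 2 < w y"
    by (rule eventually_cball_subset)
  \<comment> \<open>This is \<open>a / 2 * \<eta>\<close> for the lower bound
    \<open>a = w x / 2\<close> of the weight, as \<open>weighted_ratio_bound\<close>
    requires.\<close>
  have "0 < w x / 2 / 2 * \<eta>"
    using wx \<eta> by simp
  from measure_ball_approx[OF this] eventually_small eventually_at_right_real[OF zero_less_one] near
  show ?thesis
  proof eventually_elim
    case (elim r)
    show ?case
    proof
      fix y assume y: "y \<in> mball x r"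
      with elim have y': "d x y < R" and r: "0 < r" "r \<le> R" "r \<le> 1" and dx: "d x x < R"
        using R by auto
      have yC: "y \<in> cball x (C * r)"
        using y ball_subset_cball[OF dx r(1,2)] by blast
      have "\<bar>u y - u x\<bar> \<le> ?k * norm (y - x)"
        using elim yC by blast
      also have "\<dots> \<le> ?k * (C * r)"
        using yC by (intro mult_left_mono) (auto simp: dist_norm norm_minus_commute)
      finally have v: "\<bar>u y - u x\<bar> \<le> ?k * C * r"
        by (simp add: mult_ac)
      have m: "\<bar>measure \<mu> (dball \<Omega> d y r) - w y * measure lebesgue (mball y r)\<bar> \<le>
          w x / 2 / 2 * \<eta> * r * measure lebesgue (mball y r)"
        using elim y by blast
      have a: "w x / 2 \<le> w y"
        using elim yC by (auto intro: less_imp_le)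
      show "\<bar>measure lebesgue (mball x r) * samv_term u r y - (u y - u x)\<bar> \<le>
          ?k * C * r * (2 * volume_defect d r x y + \<eta> * r)"
        unfolding samv_term_def volume_defect_def
        by (rule weighted_ratio_bound[OF _ a _ r(1,3) _ \<eta>(2) m v])
          (use wx elim yC ball_measure_pos[OF y' r(1,2)] \<eta> in auto)
    qed
  qed
qed

text \<open>The integral of \<open>samv_term\<close> is an average after multiplication by the
  volume, and differs from the average of \<open>u - u x\<close> by \<open>o(r^2)\<close>, since the
  volume defect averages to \<open>o(r)\<close>. The weight has cancelled, so only the Hessian
  survives.\<close>

lemma
  assumes u: "C2_on \<Omega> u"
    and int: "\<forall>\<^sub>F r in at_right 0. set_integrable lebesgue (mball x r) (volume_defect d r x)"
    and small: "(\<lambda>r. avg lebesgue (mball x r) (volume_defect d r x)) \<in> o[at_right 0](\<lambda>r. r)"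
  shows set_integrable_samv_term: "\<forall>\<^sub>F r in at_right 0. set_integrable lebesgue (mball x r) (samv_term u r)"
    and samv_term_limit: "((\<lambda>r. 1 / r\<^sup>2 * (LINT y:mball x r|lebesgue. samv_term u r y)) \<longlongrightarrow>
      1 / 2 * trace (M ** hessian u x)) (at_right 0)"
proof -
  define K where "K = (norm (gradient u x) + 1) * C"
  have K: "0 < K"
    using C by (auto simp: K_def intro!: mult_pos_pos add_nonneg_pos)
  let ?b = "\<lambda>r. measure lebesgue (mball x r)"
  let ?v = "\<lambda>y. u y - u x"
  let ?e = "\<lambda>r y. ?b r * samv_term u r y - ?v y"
  have cont: "continuous_on \<Omega> ?v"
    by (intro continuous_intros C2_onD(3)[OF u])
  have linear: "linear (\<lambda>v. gradient u x \<bullet> v)"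
    by (intro bounded_linear.linear bounded_linear_inner_right)
  have meas: "\<forall>\<^sub>F r in at_right 0. set_borel_measurable lebesgue (mball x r) ?v"
    using lebesgue_balls[OF cont] by eventually_elim blast
  have "(\<lambda>y. ?v y - gradient u x \<bullet> (y - x) - (y - x) \<bullet> (((1/2) *\<^sub>R hessian u x) *v (y - x)))
      \<in> o[nhds x](\<lambda>y. (norm (y - x))\<^sup>2)"
    by (rule second_order_expansion[OF open_\<Omega> x C2_onD(1,2)[OF u]])
  note v = avg_second_order_limit[OF C bodies M linear this meas]
  have main: "\<forall>\<^sub>F r in at_right 0. set_integrable lebesgue (mball x r) (?e r) \<and>
      \<bar>1 / r\<^sup>2 * avg lebesgue (mball x r) (?e r)\<bar> \<le> \<epsilon>" if "0 < \<epsilon>" for \<epsilon>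
  proof -
    \<comment> \<open>The defect contributes \<open>2 * \<eta> * r\<close> and the weight error
      \<open>\<eta> * r\<close>, each multiplied by \<open>K * r\<close>; hence the 3.\<close>
    define \<eta> where "\<eta> = min 1 (\<epsilon> / (3 * K))"
    have \<eta>: "0 < \<eta>" "\<eta> \<le> 1" "3 * K * \<eta> \<le> \<epsilon>"
      using that K by (auto simp: \<eta>_def min_def field_simps)
    show ?thesis
      using samv_term_bound[OF u \<eta>(1,2)] int landau_o.smallD[OF small \<eta>(1)] eventually_small
    proof eventually_elim
      case (elim r)
      then have r: "0 < r" "r \<le> R" and dx: "d x x < R"
        using R by auto
      have B: "mball x r \<in> lmeasurable" "0 < ?b r"
        using ball_lmeasurable[OF dx r] ball_measure_pos[OF dx r] .
      let ?g = "\<lambda>y. K * r * (2 * volume_defect d r x y + \<eta> * r)"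
      have c: "set_integrable lebesgue (mball x r) (\<lambda>_. \<eta> * r)"
        by (rule set_integrable_const[OF B(1)])
      have d: "set_integrable lebesgue (mball x r) (\<lambda>y. 2 * volume_defect d r x y)"
        using elim(2) by simp
      have g: "set_integrable lebesgue (mball x r) ?g"
        by (intro set_integrable_mult_right set_integral_add(1) c d)
      have bound: "\<bar>?e r y\<bar> \<le> ?g y" if "y \<in> mball x r" for y
        using elim(1) that unfolding K_def by blast
      have "set_borel_measurable lebesgue (mball x r) ?v"
        "set_borel_measurable lebesgue (mball x r) (samv_term u r)"
        by (intro set_borel_measurable_ball cont dx r set_borel_measurable_samv_term C2_onD(3)[OF u])+
      then have "(\<lambda>y. ?b r * (indicator (mball x r) y *\<^sub>R samv_term u r y) - indicator (mball x r) y *\<^sub>R ?v y)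
          \<in> borel_measurable lebesgue"
        unfolding set_borel_measurable_def
        by (intro borel_measurable_diff borel_measurable_times borel_measurable_const)
      then have "set_borel_measurable lebesgue (mball x r) (?e r)"
        by (simp add: set_borel_measurable_def algebra_simps)
      then have e: "set_integrable lebesgue (mball x r) (?e r)"
        by (rule set_integrable_bound[OF g]) (use bound in \<open>force intro!: AE_I2 order_trans[OF _ abs_ge_self]\<close>)
      have "\<bar>avg lebesgue (mball x r) (?e r)\<bar> \<le> avg lebesgue (mball x r) ?g"
        using e g bound by (rule abs_avg_le)
      also have "\<dots> = K * r * (2 * avg lebesgue (mball x r) (volume_defect d r x) + \<eta> * r)"
        unfolding avg_mult avg_add[OF d c] avg_const[OF B] ..
      also have "\<dots> \<le> K * r * (2 * (\<eta> * r) + \<eta> * r)"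
        using elim(3) r K by (intro mult_left_mono add_right_mono) auto
      also have "\<dots> = 3 * K * \<eta> * r\<^sup>2"
        by (simp add: power2_eq_square)
      also have "\<dots> \<le> \<epsilon> * r\<^sup>2"
        using \<eta>(3) by (intro mult_right_mono) auto
      finally have "\<bar>1 / r\<^sup>2 * avg lebesgue (mball x r) (?e r)\<bar> \<le> \<epsilon>"
        using r by (simp add: abs_mult divide_simps)
      with e show ?case by blast
    qed
  qed
  have e0: "((\<lambda>r. 1 / r\<^sup>2 * avg lebesgue (mball x r) (?e r)) \<longlongrightarrow> 0) (at_right 0)"
    by (rule tendsto_zero_abs_leI, rule eventually_mono[OF main]) auto
  have "((\<lambda>r. 1 / r\<^sup>2 * avg lebesgue (mball x r) (?e r) + 1 / r\<^sup>2 * avg lebesgue (mball x r) ?v) \<longlongrightarrow>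
      0 + trace (M ** ((1/2) *\<^sub>R hessian u x))) (at_right 0)"
    by (intro tendsto_add e0 v(2))
  then have lim: "((\<lambda>r. 1 / r\<^sup>2 * avg lebesgue (mball x r) (?e r) + 1 / r\<^sup>2 * avg lebesgue (mball x r) ?v)
      \<longlongrightarrow> 1 / 2 * trace (M ** hessian u x)) (at_right 0)"
    by (simp add: matrix_mult_scaleR_right trace_scaleR)
  have conv: "\<forall>\<^sub>F r in at_right 0. set_integrable lebesgue (mball x r) (samv_term u r) \<and>
      1 / r\<^sup>2 * avg lebesgue (mball x r) (?e r) + 1 / r\<^sup>2 * avg lebesgue (mball x r) ?v =
      1 / r\<^sup>2 * (LINT y:mball x r|lebesgue. samv_term u r y)"
    using main[OF zero_less_one] v(1) eventually_small
  proof eventually_elim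
    case (elim r)
    then have r: "0 < r" "r \<le> R" and dx: "d x x < R"
      using R by auto
    have b: "0 < ?b r"
      using ball_measure_pos[OF dx r] .
    have e: "set_integrable lebesgue (mball x r) (?e r)" and iv: "set_integrable lebesgue (mball x r) ?v"
      using elim by blast+
    have "set_integrable lebesgue (mball x r) (\<lambda>y. ?b r * samv_term u r y)"
      using set_integral_add(1)[OF e iv] by simp
    then have "set_integrable lebesgue (mball x r) (samv_term u r)"
      using b by simp
    moreover have "avg lebesgue (mball x r) (?e r) + avg lebesgue (mball x r) ?v =
        (LINT y:mball x r|lebesgue. samv_term u r y)"
      using avg_add[OF e iv] b by (simp add: avg_def)
    ultimately show ?case
      by (simp only: distrib_left[symmetric])
  qed
  show "\<forall>\<^sub>F r in at_right 0. set_integrable lebesgue (mball x r) (samv_term u r)"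
    using conv by eventually_elim blast
  show "((\<lambda>r. 1 / r\<^sup>2 * (LINT y:mball x r|lebesgue. samv_term u r y)) \<longlongrightarrow>
      1 / 2 * trace (M ** hessian u x)) (at_right 0)"
    by (rule Lim_transform_eventually[OF lim], rule eventually_mono[OF conv]) blast
qed

text \<open>Inherited from the moment matrices by uniqueness of limits. It is needed because
  \<open>grad_weighted_grad\<close> and the AMV formula pair the gradients of \<open>u\<close> and
  \<open>w\<close> in opposite orders.\<close>

lemma M_symmetric: "transpose M = M"
proof -
  have lim: "((\<lambda>r. moment_matrix d r x $ i $ j) \<longlongrightarrow> M $ i $ j) (at_right 0)" for i j
    by (intro tendsto_vec_nth M)
  have "M $ i $ j = M $ j $ i" for i j
    using lim[of i j] lim[of j i] unfolding moment_matrix_sym[of d _ x j i]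
    by (rule tendsto_unique[OF trivial_limit_at_right_real])
  then show ?thesis
    by (simp add: transpose_def vec_eq_iff)
qed

text \<open>The summand 1 of the symmetrizing factor gives half the AMV quotient; in the other
  summand the measure of the ball around \<open>x\<close> cancels against the normalization and
  leaves half the integral of \<open>samv_term\<close>. Hence the Hessian term keeps its coefficient
  while the drift term is halved.\<close>

lemma
  assumes u: "C2_on \<Omega> u"
    and int: "\<forall>\<^sub>F r in at_right 0. set_integrable lebesgue (mball x r) (volume_defect d r x)"
    and small: "(\<lambda>r. avg lebesgue (mball x r) (volume_defect d r x)) \<in> o[at_right 0](\<lambda>r. r)"
  shows set_integrable_samv_integrand:
      "\<forall>\<^sub>F r in at_right 0. set_integrable \<mu> (dball \<Omega> d x r) (samv_integrand \<Omega> d \<mu> r u x)"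
    and samv_limit: "((\<lambda>r. samv_quot \<Omega> d \<mu> r u x) \<longlongrightarrow>
      1 / (2 * w x) * trace (M ** grad_weighted_grad w u x)) (at_right 0)"
proof -
  let ?f = "\<lambda>y. u y - u x"
  have cont: "continuous_on \<Omega> ?f" "continuous_on \<Omega> (\<lambda>y. w y * ?f y)"
    by (intro continuous_intros C2_onD(3)[OF u] w_continuous)+
  have wint: "\<forall>\<^sub>F r in at_right 0. set_integrable lebesgue (mball x r) (\<lambda>y. w y * ?f y)"
    using lebesgue_balls[OF cont(2)] isCont_continuous_on[OF cont(2)] by (rule set_integrable_near)
  have conv: "\<forall>\<^sub>F r in at_right 0. set_integrable \<mu> (dball \<Omega> d x r) (samv_integrand \<Omega> d \<mu> r u x) \<and>
      1 / 2 * amv_quot \<Omega> d \<mu> r u x + 1 / 2 * (1 / r\<^sup>2 * (LINT y:mball x r|lebesgue. samv_term u r y)) =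
      samv_quot \<Omega> d \<mu> r u x"
    using wint set_integrable_samv_term[OF assms] weighted_balls[OF cont(1)] eventually_small
  proof eventually_elim
    case (elim r)
    then have r: "0 < r" "r \<le> R" and dx: "d x x < R"
      using R by auto
    let ?B = "mball x r" and ?m = "measure \<mu> (mball x r)"
    have m: "0 < ?m"
      using elim by blast
    have eq: "samv_integrand \<Omega> d \<mu> r u x = (\<lambda>y. ?f y * (1 + ?m / measure \<mu> (dball \<Omega> d y r)))"
      by (rule ext) (simp add: samv_integrand_def lebesgue_value_C2[OF u] ball_eq[OF dx r])
    have f: "set_borel_measurable lebesgue ?B ?f"
      by (intro set_borel_measurable_ball cont dx r)
    have "(\<lambda>y. (indicator ?B y *\<^sub>R ?f y) *
        (1 + ?m / (indicator ?B y *\<^sub>R measure \<mu> (dball \<Omega> d y r)))) \<in> borel_measurable lebesgue"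
      using f set_borel_measurable_measure_ball[OF r, of r] unfolding set_borel_measurable_def
      by (intro borel_measurable_times borel_measurable_add borel_measurable_divide) simp_all
    moreover have "(\<lambda>y. (indicator ?B y *\<^sub>R ?f y) *
        (1 + ?m / (indicator ?B y *\<^sub>R measure \<mu> (dball \<Omega> d y r)))) =
        (\<lambda>y. indicator ?B y *\<^sub>R samv_integrand \<Omega> d \<mu> r u x y)"
      unfolding eq by (auto split: split_indicator)
    ultimately have meas: "set_borel_measurable lebesgue ?B (samv_integrand \<Omega> d \<mu> r u x)"
      by (simp add: set_borel_measurable_def)
    have split: "(\<lambda>y. w y * samv_integrand \<Omega> d \<mu> r u x y) = (\<lambda>y. w y * ?f y + ?m * samv_term u r y)"
      unfolding eq by (auto simp: samv_term_def algebra_simps)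
    have int1: "set_integrable lebesgue ?B (\<lambda>y. w y * ?f y)"
      and int2: "set_integrable lebesgue ?B (\<lambda>y. ?m * samv_term u r y)"
      using elim by auto
    have "set_integrable \<mu> ?B (samv_integrand \<Omega> d \<mu> r u x)"
      unfolding set_integral_ball(1)[OF meas r] split by (rule set_integral_add(1)[OF int1 int2])
    moreover have "(LINT y:?B|\<mu>. samv_integrand \<Omega> d \<mu> r u x y) =
        (LINT y:?B|\<mu>. ?f y) + ?m * (LINT y:?B|lebesgue. samv_term u r y)"
      unfolding set_integral_ball(2)[OF meas r] set_integral_ball(2)[OF f r] split
      by (simp add: set_integral_add(2)[OF int1 int2])
    ultimately show ?case
      using m r by (simp add: samv_quot_def amv_quot_def avg_def lebesgue_value_C2[OF u] ball_eq[OF dx r]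
          field_simps)
  qed
  show "\<forall>\<^sub>F r in at_right 0. set_integrable \<mu> (dball \<Omega> d x r) (samv_integrand \<Omega> d \<mu> r u x)"
    using conv by eventually_elim blast
  have "((\<lambda>r. 1 / 2 * amv_quot \<Omega> d \<mu> r u x +
      1 / 2 * (1 / r\<^sup>2 * (LINT y:mball x r|lebesgue. samv_term u r y))) \<longlongrightarrow>
      1 / 2 * (1 / 2 * trace (M ** hessian u x) + 1 / w x * (gradient w x \<bullet> (M *v gradient u x))) +
      1 / 2 * (1 / 2 * trace (M ** hessian u x))) (at_right 0)"
    by (intro tendsto_add tendsto_mult_left amv_limit[OF u] samv_term_limit[OF assms])
  moreover have "gradient u x \<bullet> (M *v gradient w x) = gradient w x \<bullet> (M *v gradient u x)"
    by (metis M_symmetric dot_lmul_matrix inner_commute transpose_matrix_vector)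
  then have "1 / 2 * (1 / 2 * trace (M ** hessian u x) + 1 / w x * (gradient w x \<bullet> (M *v gradient u x))) +
      1 / 2 * (1 / 2 * trace (M ** hessian u x)) = 1 / (2 * w x) * trace (M ** grad_weighted_grad w u x)"
    using wx by (simp add: grad_weighted_grad_def matrix_add_ldistrib trace_add matrix_mult_scaleR_right
        trace_scaleR trace_mult_outer_product field_simps)
  ultimately have lim: "((\<lambda>r. 1 / 2 * amv_quot \<Omega> d \<mu> r u x +
      1 / 2 * (1 / r\<^sup>2 * (LINT y:mball x r|lebesgue. samv_term u r y))) \<longlongrightarrow>
      1 / (2 * w x) * trace (M ** grad_weighted_grad w u x)) (at_right 0)"
    by simp
  show "((\<lambda>r. samv_quot \<Omega> d \<mu> r u x) \<longlongrightarrow>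
      1 / (2 * w x) * trace (M ** grad_weighted_grad w u x)) (at_right 0)"
    by (rule Lim_transform_eventually[OF lim], rule eventually_mono[OF conv]) blast
qed

end

theorem proposition5p3:
  fixes \<Omega> :: "(real^'n) set"
    and d :: "real^'n \<Rightarrow> real^'n \<Rightarrow> real"
    and w :: "real^'n \<Rightarrow> real"
    and x :: "real^'n"
    and M :: "real^'n^'n"
  assumes metric: "Metric_space UNIV d"
    and d_open: "dopen UNIV d \<Omega>"
    and euclidean_open: "open \<Omega>"
    and symmetric: "symmetric_balls \<Omega> d"
    and w_C1: "C1_on \<Omega> w"
    and w_nonneg: "\<forall>y\<in>\<Omega>. 0 \<le> w y"
    and mms: "metric_measure_space \<Omega> d (weighted_measure \<Omega> w)"
    and x: "x \<in> \<Omega>" "w x > 0"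
    and finite_volume: "\<forall>\<^sub>F r in at_right 0. dball UNIV d x r \<in> lmeasurable"
    and M: "((\<lambda>r. moment_matrix d r x) \<longlongrightarrow> M) (at_right 0)"
  shows "(\<forall>u. C2_on \<Omega> u \<longrightarrow>
            admits_amv_laplacian \<Omega> d (weighted_measure \<Omega> w) u x \<and>
            amv_laplacian \<Omega> d (weighted_measure \<Omega> w) u x =
              1 / 2 * trace (M ** hessian u x) +
              1 / w x * (gradient w x \<bullet> (M *v gradient u x))) \<and>
         ((\<forall>\<^sub>F r in at_right 0.
             set_integrable lebesgue (dball UNIV d x r) (volume_defect d r x)) \<and>
          (\<lambda>r. avg lebesgue (dball UNIV d x r) (volume_defect d r x)) \<in> o[at_right 0](\<lambda>r. r)
          \<longrightarrow>
          (\<forall>u. C2_on \<Omega> u \<longrightarrow>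
            admits_samv_laplacian \<Omega> d (weighted_measure \<Omega> w) u x \<and>
            samv_laplacian \<Omega> d (weighted_measure \<Omega> w) u x =
              1 / (2 * w x) * trace (M ** grad_weighted_grad w u x)))"
proof -
  have "continuous_on \<Omega> w"
    using w_C1 by (auto simp: C1_on_def intro!: continuous_at_imp_continuous_on
        differentiable_imp_continuous_within)
  from comparable_balls[OF metric d_open euclidean_open symmetric this mms x(1) finite_volume]
  obtain R C where RC: "0 < R" "0 < C"
    "\<And>y r. \<lbrakk>d x y < R; 0 < r; r \<le> R\<rbrakk> \<Longrightarrow> dball UNIV d y r \<subseteq> \<Omega> \<and>
      symmetric_body (dball UNIV d y r) y \<and> dball UNIV d y r \<subseteq> cball y (C * r)"
    by blast
  interpret Metric_space UNIV d
    by (rule metric)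
  interpret weighted_balls d \<Omega> w x M R C
    by unfold_locales (fact euclidean_open w_C1 w_nonneg mms x M RC)+
  have lim: "Lim (at_right 0) f = L" if "(f \<longlongrightarrow> L) (at_right 0)" for f :: "real \<Rightarrow> real" and L
    using tendsto_Lim[OF trivial_limit_at_right_real that] .
  show ?thesis
  proof (intro conjI impI allI)
    fix u
    assume u: "C2_on \<Omega> u"
    show "admits_amv_laplacian \<Omega> d \<mu> u x"
      unfolding admits_amv_laplacian_def using lebesgue_point_C2[OF u] amv_limit[OF u] by blast
    show "amv_laplacian \<Omega> d \<mu> u x =
        1 / 2 * trace (M ** hessian u x) + 1 / w x * (gradient w x \<bullet> (M *v gradient u x))"
      unfolding amv_laplacian_def by (rule lim[OF amv_limit[OF u]])
  next
    fix u
    assume defect: "(\<forall>\<^sub>F r in at_right 0. set_integrable lebesgue (dball UNIV d x r) (volume_defect d r x)) \<and>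
        (\<lambda>r. avg lebesgue (dball UNIV d x r) (volume_defect d r x)) \<in> o[at_right 0](\<lambda>r. r)"
      and u: "C2_on \<Omega> u"
    note samv = samv_limit[OF u conjunct1[OF defect] conjunct2[OF defect]]
    show "admits_samv_laplacian \<Omega> d \<mu> u x"
      unfolding admits_samv_laplacian_def
      using lebesgue_point_C2[OF u] samv
        set_integrable_samv_integrand[OF u conjunct1[OF defect] conjunct2[OF defect]] by blast
    show "samv_laplacian \<Omega> d \<mu> u x = 1 / (2 * w x) * trace (M ** grad_weighted_grad w u x)"
      unfolding samv_laplacian_def by (rule lim[OF samv])
  qed
qed

end
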